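(* The operators $$(T_i\psi)(x)=\chi_{R_i}(x)\,(\Phi_{\sigma_i}(\sigma(x)))^{-1/2}\,\psi(\sigma(x)),\qquad i=0,\dots,N-1,$$ and their adjoints, acting on $L^2(\Lambda_A,\mu_A)$, define a representation of the Cuntz–Krieger algebra $O_A$ with generators $S_i=T_i$.
   Context: Let $A=(A_{ij})_{i,j=0,\dots,N-1}$ ($N\ge2$) be a matrix with entries in $\{0,1\}$ and $A_{ii}=1$ for all $i$. $\Lambda_A$ is the set of infinite sequences $x=(x_1x_2x_3\dots)$ with $x_i\in\{0,\dots,N-1\}$ and $A_{x_ix_{i+1}}=1$ for all $i\ge1$. It is identified with a subset of $[0,1]$ through the value $\mathrm{val}(x)=\sum_{i\ge1}x_iN^{-i}$, points with two admissible expansions being counted as two points. $\delta_A$ is the Hausdorff dimension of $\mathrm{val}(\Lambda_A)\subset[0,1]$, and $\mu_A$ is the $\delta_A$-dimensional Hausdorff measure $\mathcal{H}^{\delta_A}$ on $\Lambda_A$, i.e. $\mu_A(B)=\int_{[0,1]}\#\{w\in B:\mathrm{val}(w)=y\}\,d\mathcal{H}^{\delta_A}(y)$. $\sigma(x_1x_2x_3\dots)=(x_2x_3\dots)$ is the shift on $\Lambda_A$; $D_i=\{x\in\Lambda_A:A_{ix_1}=1\}$, $R_i=\{x\in\Lambda_A:x_1=i\}$, $\sigma_i:D_i\to R_i$, $\sigma_i(x)=ix$, and $\Phi_{\sigma_i}=d(\mu_A\circ\sigma_i)/d\mu_A$ is the Radon–Nikodym derivative on $D_i$. The Cuntz–Krieger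 algebra $O_A$ is the $C^*$-algebra generated by partial isometries $S_0,\dots,S_{N-1}$ with relations $S_i^*S_i=\sum_jA_{ij}S_jS_j^*$ and $\sum_iS_iS_i^*=1$; operators on a Hilbert space satisfying these relations define a representation of $O_A$. *)

theory Defs
  imports "HOL-Analysis.Analysis"
begin

text \<open>
  The contribution of one covering set is diam(U)^s, with the usual conventions that the empty set
  contributes 0 and that 0^0 = 1, so that the 0-dimensional measure is counting measure
  (whereas \<open>0 powr 0 = 0\<close> in HOL).
\<close>

definition hausdorff_gauge :: "real \<Rightarrow> 'a::metric_space set \<Rightarrow> ennreal" where
  "hausdorff_gauge s U =
     (if U = {} then 0 else if s = 0 then 1 else ennreal (diameter U powr s))"

text \<open>The library's \<^const>\<open>diameter\<close> is meaningful on bounded sets only, hence \<^const>\<open>bounded\<close>.\<close>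

definition hausdorff_premeasure :: "real \<Rightarrow> real \<Rightarrow> 'a::metric_space set \<Rightarrow> ennreal" where
  "hausdorff_premeasure s \<epsilon> E =
     (INF U \<in> {U :: nat \<Rightarrow> 'a set. E \<subseteq> (\<Union>n. U n) \<and> (\<forall>n. bounded (U n) \<and> diameter (U n) \<le> \<epsilon>)}.
        \<Sum>n. hausdorff_gauge s (U n))"

definition hausdorff_outer :: "real \<Rightarrow> 'a::metric_space set \<Rightarrow> ennreal" where
  "hausdorff_outer s E = (SUP \<epsilon> \<in> {0<..}. hausdorff_premeasure s \<epsilon> E)"

definition hausdorff_measure :: "real \<Rightarrow> 'a::metric_space measure" where
  "hausdorff_measure s = measure_of UNIV (sets borel) (hausdorff_outer s)"

text \<open>In Euclidean space the set below is nonempty, since it contains every \<open>s > DIM('a)\<close>.\<close>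

definition hausdorff_dim :: "'a::euclidean_space set \<Rightarrow> real" where
  "hausdorff_dim E = Inf {s. 0 \<le> s \<and> hausdorff_outer s E = 0}"


text \<open>
  A sequence \<open>(x\<^sub>1, x\<^sub>2, \<dots>)\<close> is a function on \<^typ>\<open>nat\<close> whose value at \<open>k\<close> is \<open>x\<^bsub>k+1\<^esub>\<close>.
  Only the entries \<open>A i j\<close> with \<open>i, j < N\<close> matter.
\<close>

definition Lam :: "nat \<Rightarrow> (nat \<Rightarrow> nat \<Rightarrow> nat) \<Rightarrow> (nat \<Rightarrow> nat) set" where
  "Lam N A = {x. \<forall>k. x k < N \<and> A (x k) (x (Suc k)) = 1}"

definition seq_val :: "nat \<Rightarrow> (nat \<Rightarrow> nat) \<Rightarrow> real" where
  "seq_val N x = (\<Sum>k. real (x k) / real N ^ Suc k)"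

definition delta :: "nat \<Rightarrow> (nat \<Rightarrow> nat \<Rightarrow> nat) \<Rightarrow> real" where
  "delta N A = hausdorff_dim (seq_val N ` Lam N A)"

text \<open>
  The \<open>\<sigma>\<close>-algebra is the Borel algebra of the product topology (\<^typ>\<open>nat\<close> being discrete), i.e. the
  one generated by the cylinder sets. The number of points of a fibre is its counting measure.
\<close>

definition mu :: "nat \<Rightarrow> (nat \<Rightarrow> nat \<Rightarrow> nat) \<Rightarrow> (nat \<Rightarrow> nat) measure" where
  "mu N A = measure_of (Lam N A) (sets (restrict_space borel (Lam N A)))
     (\<lambda>B. set_nn_integral (hausdorff_measure (delta N A)) {0..1}
            (\<lambda>y. emeasure (count_space UNIV) {w \<in> B. seq_val N w = y}))"

definition shift :: "(nat \<Rightarrow> nat) \<Rightarrow> (nat \<Rightarrow> nat)" where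
  "shift x = (\<lambda>k. x (Suc k))"

definition prepend :: "nat \<Rightarrow> (nat \<Rightarrow> nat) \<Rightarrow> (nat \<Rightarrow> nat)" where
  "prepend i x = (\<lambda>k. case k of 0 \<Rightarrow> i | Suc n \<Rightarrow> x n)"

definition Dset :: "nat \<Rightarrow> (nat \<Rightarrow> nat \<Rightarrow> nat) \<Rightarrow> nat \<Rightarrow> (nat \<Rightarrow> nat) set" where
  "Dset N A i = {x \<in> Lam N A. A i (x 0) = 1}"

definition Rset :: "nat \<Rightarrow> (nat \<Rightarrow> nat \<Rightarrow> nat) \<Rightarrow> nat \<Rightarrow> (nat \<Rightarrow> nat) set" where
  "Rset N A i = {x \<in> Lam N A. x 0 = i}"

definition mu_prepend :: "nat \<Rightarrow> (nat \<Rightarrow> nat \<Rightarrow> nat) \<Rightarrow> nat \<Rightarrow> (nat \<Rightarrow> nat) measure" where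
  "mu_prepend N A i =
     measure_of (Dset N A i) (sets (restrict_space (mu N A) (Dset N A i)))
       (\<lambda>B. emeasure (mu N A) (prepend i ` B))"

definition Phi :: "nat \<Rightarrow> (nat \<Rightarrow> nat \<Rightarrow> nat) \<Rightarrow> nat \<Rightarrow> (nat \<Rightarrow> nat) \<Rightarrow> real" where
  "Phi N A i x = enn2real (RN_deriv (restrict_space (mu N A) (Dset N A i)) (mu_prepend N A i) x)"


record 'v hspace =
  hcarrier :: "'v set"
  hzero :: 'v
  hadd :: "'v \<Rightarrow> 'v \<Rightarrow> 'v"
  hscale :: "complex \<Rightarrow> 'v \<Rightarrow> 'v"
  hinner :: "'v \<Rightarrow> 'v \<Rightarrow> complex"

definition hnorm :: "'v hspace \<Rightarrow> 'v \<Rightarrow> real" where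
  "hnorm H x = sqrt (Re (hinner H x x))"

definition hdist :: "'v hspace \<Rightarrow> 'v \<Rightarrow> 'v \<Rightarrow> real" where
  "hdist H x y = hnorm H (hadd H x (hscale H (-1) y))"

text \<open>Inner products are linear in the first and conjugate linear in the second argument.\<close>

locale complex_hilbert_space =
  fixes H :: "'v hspace"
  assumes zero_closed: "hzero H \<in> hcarrier H"
    and add_closed: "\<lbrakk>x \<in> hcarrier H; y \<in> hcarrier H\<rbrakk> \<Longrightarrow> hadd H x y \<in> hcarrier H"
    and scale_closed: "x \<in> hcarrier H \<Longrightarrow> hscale H c x \<in> hcarrier H"
    and add_assoc: "\<lbrakk>x \<in> hcarrier H; y \<in> hcarrier H; z \<in> hcarrier H\<rbrakk>
          \<Longrightarrow> hadd H (hadd H x y) z = hadd H x (hadd H y z)"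
    and add_commute: "\<lbrakk>x \<in> hcarrier H; y \<in> hcarrier H\<rbrakk> \<Longrightarrow> hadd H x y = hadd H y x"
    and add_zero: "x \<in> hcarrier H \<Longrightarrow> hadd H x (hzero H) = x"
    and add_inverse: "x \<in> hcarrier H \<Longrightarrow> hadd H x (hscale H (-1) x) = hzero H"
    and scale_add_right: "\<lbrakk>x \<in> hcarrier H; y \<in> hcarrier H\<rbrakk>
          \<Longrightarrow> hscale H c (hadd H x y) = hadd H (hscale H c x) (hscale H c y)"
    and scale_add_left: "x \<in> hcarrier H
          \<Longrightarrow> hscale H (c + d) x = hadd H (hscale H c x) (hscale H d x)"
    and scale_scale: "x \<in> hcarrier H \<Longrightarrow> hscale H c (hscale H d x) = hscale H (c * d) x"
    and scale_one: "x \<in> hcarrier H \<Longrightarrow> hscale H 1 x = x"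
    and inner_add_left: "\<lbrakk>x \<in> hcarrier H; y \<in> hcarrier H; z \<in> hcarrier H\<rbrakk>
          \<Longrightarrow> hinner H (hadd H x y) z = hinner H x z + hinner H y z"
    and inner_scale_left: "\<lbrakk>x \<in> hcarrier H; y \<in> hcarrier H\<rbrakk>
          \<Longrightarrow> hinner H (hscale H c x) y = c * hinner H x y"
    and inner_commute: "\<lbrakk>x \<in> hcarrier H; y \<in> hcarrier H\<rbrakk> \<Longrightarrow> hinner H x y = cnj (hinner H y x)"
    and inner_nonneg: "x \<in> hcarrier H \<Longrightarrow> 0 \<le> Re (hinner H x x)"
    and inner_definite: "\<lbrakk>x \<in> hcarrier H; hinner H x x = 0\<rbrakk> \<Longrightarrow> x = hzero H"
    and complete: "\<lbrakk>\<And>n. X n \<in> hcarrier H;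
            \<And>e. e > 0 \<Longrightarrow> \<exists>n0. \<forall>m\<ge>n0. \<forall>n\<ge>n0. hdist H (X m) (X n) < e\<rbrakk>
          \<Longrightarrow> \<exists>x\<in>hcarrier H. (\<lambda>n::nat. hdist H (X n) x) \<longlonglongrightarrow> 0"

definition hbounded_op :: "'v hspace \<Rightarrow> ('v \<Rightarrow> 'v) \<Rightarrow> bool" where
  "hbounded_op H T \<longleftrightarrow>
     (\<forall>x\<in>hcarrier H. T x \<in> hcarrier H) \<and>
     (\<forall>x\<in>hcarrier H. \<forall>y\<in>hcarrier H. T (hadd H x y) = hadd H (T x) (T y)) \<and>
     (\<forall>c. \<forall>x\<in>hcarrier H. T (hscale H c x) = hscale H c (T x)) \<and>
     (\<exists>K. \<forall>x\<in>hcarrier H. hnorm H (T x) \<le> K * hnorm H x)"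

text \<open>By the Riesz representation theorem the vector is unique and exists, for bounded operators.\<close>

definition hadjoint :: "'v hspace \<Rightarrow> ('v \<Rightarrow> 'v) \<Rightarrow> 'v \<Rightarrow> 'v" where
  "hadjoint H T y =
     (THE z. z \<in> hcarrier H \<and> (\<forall>x\<in>hcarrier H. hinner H (T x) y = hinner H x z))"

definition hpartial_isometry :: "'v hspace \<Rightarrow> ('v \<Rightarrow> 'v) \<Rightarrow> bool" where
  "hpartial_isometry H T \<longleftrightarrow> (\<forall>x\<in>hcarrier H. T (hadjoint H T (T x)) = T x)"

primrec hsum :: "'v hspace \<Rightarrow> (nat \<Rightarrow> 'v) \<Rightarrow> nat \<Rightarrow> 'v" where
  "hsum H f 0 = hzero H"
| "hsum H f (Suc n) = hadd H (hsum H f n) (f n)"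

definition cuntz_krieger_rep ::
  "nat \<Rightarrow> (nat \<Rightarrow> nat \<Rightarrow> nat) \<Rightarrow> 'v hspace \<Rightarrow> (nat \<Rightarrow> 'v \<Rightarrow> 'v) \<Rightarrow> bool" where
  "cuntz_krieger_rep N A H S \<longleftrightarrow>
     complex_hilbert_space H \<and>
     (\<forall>i<N. hbounded_op H (S i) \<and> hpartial_isometry H (S i)) \<and>
     (\<forall>i<N. \<forall>x\<in>hcarrier H.
        hadjoint H (S i) (S i x) =
        hsum H (\<lambda>j. hscale H (of_nat (A i j)) (S j (hadjoint H (S j) x))) N) \<and>
     (\<forall>x\<in>hcarrier H. hsum H (\<lambda>i. S i (hadjoint H (S i) x)) N = x)"


definition sq_integrable :: "'a measure \<Rightarrow> ('a \<Rightarrow> complex) set" where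
  "sq_integrable M = {f \<in> borel_measurable M. integrable M (\<lambda>x. (cmod (f x))\<^sup>2)}"

definition L2_rel :: "'a measure \<Rightarrow> (('a \<Rightarrow> complex) \<times> ('a \<Rightarrow> complex)) set" where
  "L2_rel M = {(f, g). f \<in> sq_integrable M \<and> g \<in> sq_integrable M \<and> (AE x in M. f x = g x)}"

definition L2_class :: "'a measure \<Rightarrow> ('a \<Rightarrow> complex) \<Rightarrow> ('a \<Rightarrow> complex) set" where
  "L2_class M f = L2_rel M `` {f}"

text \<open>
  The unions lift operations from representatives to classes: for an operation respecting
  \<open>L2_rel\<close> all the sets in a union coincide.
\<close>

definition L2_space :: "'a measure \<Rightarrow> ('a \<Rightarrow> complex) set hspace" where
  "L2_space M =
     \<lparr>hcarrier = sq_integrable M // L2_rel M,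
      hzero = L2_class M (\<lambda>x. 0),
      hadd = (\<lambda>F G. \<Union>f\<in>F. \<Union>g\<in>G. L2_class M (\<lambda>x. f x + g x)),
      hscale = (\<lambda>c F. \<Union>f\<in>F. L2_class M (\<lambda>x. c * f x)),
      hinner = (\<lambda>F G. the_elem (\<Union>f\<in>F. \<Union>g\<in>G. {LINT x|M. f x * cnj (g x)}))\<rparr>"


definition T_fun ::
  "nat \<Rightarrow> (nat \<Rightarrow> nat \<Rightarrow> nat) \<Rightarrow> nat \<Rightarrow> ((nat \<Rightarrow> nat) \<Rightarrow> complex) \<Rightarrow> (nat \<Rightarrow> nat) \<Rightarrow> complex" where
  "T_fun N A i \<psi> x =
     indicator (Rset N A i) x * of_real (Phi N A i (shift x) powr (- 1 / 2)) * \<psi> (shift x)"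

definition T_op ::
  "nat \<Rightarrow> (nat \<Rightarrow> nat \<Rightarrow> nat) \<Rightarrow> nat \<Rightarrow> ((nat \<Rightarrow> nat) \<Rightarrow> complex) set \<Rightarrow> ((nat \<Rightarrow> nat) \<Rightarrow> complex) set" where
  "T_op N A i F = (\<Union>\<psi>\<in>F. L2_class (mu N A) (T_fun N A i \<psi>))"

end

theory Submission
  imports Defs
begin

text \<open>
  Let \<open>r = N\<^bsup>-\<delta>\<^esup>\<close> with \<open>\<delta>\<close> the Hausdorff dimension. Prepending the symbol \<open>i\<close> acts on values as the
  similarity \<open>y \<mapsto> (i + y) / N\<close>, which multiplies the \<open>\<delta>\<close>-dimensional Hausdorff measure by \<open>r\<close>, so
  \<open>\<mu> (\<sigma>\<^sub>i B) = r \<mu> B\<close> for \<open>B \<subseteq> D\<^sub>i\<close> (\<open>emeasure_mu_prepend\<close>) and the Radon--Nikodym derivative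
  \<open>\<Phi>\<^bsub>\<sigma>\<^sub>i\<^esub>\<close> can be taken to be the constant \<open>r\<close>. Hence \<open>T\<^sub>i \<psi> = \<chi>\<^bsub>R\<^sub>i\<^esub> r\<^bsup>-1/2\<^esup> (\<psi> \<circ> \<sigma>)\<close>, its adjoint is
  \<open>\<phi> \<mapsto> \<chi>\<^bsub>D\<^sub>i\<^esub> r\<^bsup>1/2\<^esup> (\<phi> \<circ> \<sigma>\<^sub>i)\<close>, and \<open>T\<^sub>i T\<^sub>i\<^sup>*\<close>, \<open>T\<^sub>i\<^sup>* T\<^sub>i\<close> are the multiplications by \<open>\<chi>\<^bsub>R\<^sub>i\<^esub>\<close> and
  \<open>\<chi>\<^bsub>D\<^sub>i\<^esub>\<close>. The Cuntz--Krieger relations then express that the \<open>R\<^sub>j\<close> partition the sequence space and that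
  \<open>D\<^sub>i\<close> is the union of the \<open>R\<^sub>j\<close> with \<open>A\<^bsub>ij\<^esub> = 1\<close>.

  Neither the dimension nor the measure has to be known. The scaling law is purely geometric: it
  comes from the action of similarities on covers, and passes to the integrals over the fibres by a
  change of variables valid for arbitrary integrands (\<open>nn_integral_hausdorff_similarity\<close>). Nor is
  \<open>\<sigma>\<close>-finiteness of \<open>\<mu>\<close> needed. Where the measure is not \<open>\<sigma>\<close>-finite the derivative need not be
  \<open>r\<close> almost everywhere, but the set where a square-integrable function does not vanish is
  \<open>\<sigma>\<close>-finite, and there it is (\<open>AE_density_const_unique\<close>); this is all that \<open>T\<^sub>i\<close> can see.

  That \<open>L\<^sup>2\<close> is a Hilbert space, for any measure, is proved by the usual Riesz--Fischer argument
  (\<open>L2_space_complete\<close>).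
\<close>

section \<open>The Hilbert space \<open>L\<^sup>2(M)\<close>\<close>

lemma sq_integrable_measurable: "f \<in> sq_integrable M \<Longrightarrow> f \<in> borel_measurable M"
  by (simp add: sq_integrable_def)

lemma sq_integrable_integrable: "f \<in> sq_integrable M \<Longrightarrow> integrable M (\<lambda>x. (cmod (f x))\<^sup>2)"
  by (simp add: sq_integrable_def)

lemma sq_integrable_bound:
  assumes "f \<in> borel_measurable M" "integrable M h"
    and "AE x in M. (cmod (f x))\<^sup>2 \<le> h x"
  shows "f \<in> sq_integrable M"
proof -
  have [measurable]: "f \<in> borel_measurable M" by fact
  have "AE x in M. norm ((cmod (f x))\<^sup>2) \<le> norm (h x)"
    using assms(3) by eventually_elim auto
  then show ?thesis
    using assms(2) by (auto simp: sq_integrable_def intro: Bochner_Integration.integrable_bound)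
qed

lemma sq_integrable_zero: "(\<lambda>x. 0) \<in> sq_integrable M"
  by (simp add: sq_integrable_def)

lemma cmod_add_sq_le: "(cmod (a + b))\<^sup>2 \<le> 2 * (cmod a)\<^sup>2 + 2 * (cmod b)\<^sup>2"
proof -
  have "(cmod (a + b))\<^sup>2 \<le> (cmod a + cmod b)\<^sup>2"
    by (intro power_mono norm_triangle_ineq) auto
  also have "\<dots> \<le> 2 * (cmod a)\<^sup>2 + 2 * (cmod b)\<^sup>2"
    using sum_squares_bound[of "cmod a" "cmod b"] by (simp add: power2_sum)
  finally show ?thesis .
qed

lemma sq_integrable_add:
  assumes "f \<in> sq_integrable M" "g \<in> sq_integrable M"
  shows "(\<lambda>x. f x + g x) \<in> sq_integrable M"
proof (rule sq_integrable_bound)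
  show "integrable M (\<lambda>x. 2 * (cmod (f x))\<^sup>2 + 2 * (cmod (g x))\<^sup>2)"
    using assms[THEN sq_integrable_integrable] by simp
qed (use assms[THEN sq_integrable_measurable] cmod_add_sq_le in auto)

lemma sq_integrable_scale:
  assumes "f \<in> sq_integrable M"
  shows "(\<lambda>x. c * f x) \<in> sq_integrable M"
  using assms by (auto simp: sq_integrable_def norm_mult power_mult_distrib)

lemma sq_integrable_diff:
  assumes "f \<in> sq_integrable M" "g \<in> sq_integrable M"
  shows "(\<lambda>x. f x - g x) \<in> sq_integrable M"
  using sq_integrable_add[OF assms(1) sq_integrable_scale[OF assms(2), of "-1"]] by simp

lemma sq_integrable_sum:
  fixes n :: nat
  assumes "\<And>j. j < n \<Longrightarrow> f j \<in> sq_integrable M"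
  shows "(\<lambda>x. \<Sum>j<n. f j x) \<in> sq_integrable M"
  using assms by (induction n) (auto intro: sq_integrable_zero sq_integrable_add)

lemma sq_integrable_mult_cnj:
  assumes "f \<in> sq_integrable M" "g \<in> sq_integrable M"
  shows "integrable M (\<lambda>x. f x * cnj (g x))"
proof (rule Bochner_Integration.integrable_bound)
  have [measurable]: "f \<in> borel_measurable M" "g \<in> borel_measurable M"
    using assms[THEN sq_integrable_measurable] by auto
  have "(\<lambda>x. cnj (g x)) \<in> borel_measurable M"
    by (rule borel_measurable_continuous_on[where f = cnj]) (auto intro: continuous_intros)
  then show "(\<lambda>x. f x * cnj (g x)) \<in> borel_measurable M" by simp
  show "integrable M (\<lambda>x. (cmod (f x))\<^sup>2 + (cmod (g x))\<^sup>2)"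
    using assms[THEN sq_integrable_integrable] by simp
  have "cmod (f x) * cmod (g x) \<le> (cmod (f x))\<^sup>2 + (cmod (g x))\<^sup>2" for x
    using sum_squares_bound[of "cmod (f x)" "cmod (g x)"]
      mult_nonneg_nonneg[OF norm_ge_zero norm_ge_zero, of "f x" "g x"]
    unfolding mult.assoc by linarith
  then show "AE x in M. norm (f x * cnj (g x)) \<le> norm ((cmod (f x))\<^sup>2 + (cmod (g x))\<^sup>2)"
    by (simp add: norm_mult)
qed

lemma equiv_L2_rel: "equiv (sq_integrable M) (L2_rel M)"
proof (rule equivI)
  show "refl_on (sq_integrable M) (L2_rel M)"
    by (auto simp: refl_on_def L2_rel_def)
  show "sym (L2_rel M)"
    by (auto simp: sym_def L2_rel_def)
  show "trans (L2_rel M)"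
  proof (rule transI)
    fix f g h
    assume fg: "(f, g) \<in> L2_rel M" and gh: "(g, h) \<in> L2_rel M"
    then have "AE x in M. f x = g x" "AE x in M. g x = h x"
      by (auto simp: L2_rel_def)
    then have "AE x in M. f x = h x"
      by eventually_elim simp
    then show "(f, h) \<in> L2_rel M"
      using fg gh by (simp add: L2_rel_def)
  qed
  show "L2_rel M \<subseteq> sq_integrable M \<times> sq_integrable M"
    by (auto simp: L2_rel_def)
qed

lemma L2_class_eq_iff:
  assumes "f \<in> sq_integrable M" "g \<in> sq_integrable M"
  shows "L2_class M f = L2_class M g \<longleftrightarrow> (AE x in M. f x = g x)"
  using eq_equiv_class_iff[OF equiv_L2_rel assms] assms by (auto simp: L2_class_def L2_rel_def)

lemma mem_L2_class_iff:
  "g \<in> L2_class M f \<longleftrightarrow> f \<in> sq_integrable M \<and> g \<in> sq_integrable M \<and> (AE x in M. f x = g x)"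
  by (auto simp: L2_class_def L2_rel_def)

lemma self_mem_L2_class: "f \<in> sq_integrable M \<Longrightarrow> f \<in> L2_class M f"
  by (simp add: mem_L2_class_iff)

lemma L2_class_closed: "f \<in> sq_integrable M \<Longrightarrow> L2_class M f \<in> hcarrier (L2_space M)"
  by (simp add: L2_space_def L2_class_def quotientI)

lemma L2_carrierE:
  assumes "F \<in> hcarrier (L2_space M)"
  obtains f where "f \<in> sq_integrable M" "F = L2_class M f"
  using assms by (auto simp: L2_space_def L2_class_def elim: quotientE)

lemma L2_zero: "hzero (L2_space M) = L2_class M (\<lambda>x. 0)"
  by (simp add: L2_space_def)

text \<open>A map on representatives that respects equality almost everywhere descends to classes.\<close>

lemma L2_lift:
  assumes "f \<in> sq_integrable M"
    and "\<And>g. g \<in> sq_integrable M \<Longrightarrow> \<Phi> g \<in> sq_integrable M"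
    and "\<And>g. g \<in> sq_integrable M \<Longrightarrow> AE x in M. f x = g x \<Longrightarrow> AE x in M. \<Phi> f x = \<Phi> g x"
  shows "(\<Union>g\<in>L2_class M f. L2_class M (\<Phi> g)) = L2_class M (\<Phi> f)"
proof -
  have "L2_class M (\<Phi> g) = L2_class M (\<Phi> f)" if "g \<in> L2_class M f" for g
    using that assms L2_class_eq_iff[of "\<Phi> f" M "\<Phi> g"] by (auto simp: mem_L2_class_iff)
  then show ?thesis
    using self_mem_L2_class[OF assms(1)] by blast
qed

lemma L2_scale:
  assumes "f \<in> sq_integrable M"
  shows "hscale (L2_space M) c (L2_class M f) = L2_class M (\<lambda>x. c * f x)"
proof -
  have "(\<Union>f\<in>L2_class M f. L2_class M (\<lambda>x. c * f x)) = L2_class M (\<lambda>x. c * f x)"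
    by (rule L2_lift) (use assms in \<open>auto intro: sq_integrable_scale\<close>)
  then show ?thesis
    by (simp add: L2_space_def)
qed

lemma L2_add:
  assumes "f \<in> sq_integrable M" "g \<in> sq_integrable M"
  shows "hadd (L2_space M) (L2_class M f) (L2_class M g) = L2_class M (\<lambda>x. f x + g x)"
proof -
  have "(\<Union>v\<in>L2_class M g. L2_class M (\<lambda>x. u x + v x)) = L2_class M (\<lambda>x. u x + g x)"
    if "u \<in> sq_integrable M" for u
    by (rule L2_lift) (use assms that in \<open>auto intro: sq_integrable_add\<close>)
  then have "(\<Union>u\<in>L2_class M f. \<Union>v\<in>L2_class M g. L2_class M (\<lambda>x. u x + v x)) =
      (\<Union>u\<in>L2_class M f. L2_class M (\<lambda>x. u x + g x))"
    by (simp add: mem_L2_class_iff)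
  also have "\<dots> = L2_class M (\<lambda>x. f x + g x)"
    by (rule L2_lift) (use assms in \<open>auto intro: sq_integrable_add\<close>)
  finally show ?thesis
    by (simp add: L2_space_def)
qed

lemma L2_inner:
  assumes "f \<in> sq_integrable M" "g \<in> sq_integrable M"
  shows "hinner (L2_space M) (L2_class M f) (L2_class M g) = (LINT x|M. f x * cnj (g x))"
proof -
  have "(LINT x|M. u x * cnj (v x)) = (LINT x|M. f x * cnj (g x))"
    if "u \<in> L2_class M f" "v \<in> L2_class M g" for u v
  proof (rule integral_cong_AE)
    show "AE x in M. u x * cnj (v x) = f x * cnj (g x)"
      using that by (auto simp: mem_L2_class_iff)
  qed (use that assms in \<open>auto simp: mem_L2_class_iff
        intro!: borel_measurable_integrable sq_integrable_mult_cnj\<close>)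
  then have "(\<Union>u\<in>L2_class M f. \<Union>v\<in>L2_class M g. {LINT x|M. u x * cnj (v x)}) =
      {LINT x|M. f x * cnj (g x)}"
    using self_mem_L2_class[OF assms(1)] self_mem_L2_class[OF assms(2)] by blast
  then show ?thesis
    by (simp add: L2_space_def)
qed

lemma L2_inner_self:
  assumes "f \<in> sq_integrable M"
  shows "hinner (L2_space M) (L2_class M f) (L2_class M f) = of_real (LINT x|M. (cmod (f x))\<^sup>2)"
proof -
  have "f x * cnj (f x) = of_real ((cmod (f x))\<^sup>2)" for x
    by (metis complex_norm_square)
  then show ?thesis
    using assms by (simp add: L2_inner del: of_real_power)
qed

lemma L2_norm:
  assumes "f \<in> sq_integrable M"
  shows "hnorm (L2_space M) (L2_class M f) = sqrt (LINT x|M. (cmod (f x))\<^sup>2)"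
  using assms by (simp add: hnorm_def L2_inner_self)

lemma L2_dist:
  assumes "f \<in> sq_integrable M" "g \<in> sq_integrable M"
  shows "hdist (L2_space M) (L2_class M f) (L2_class M g) = sqrt (LINT x|M. (cmod (f x - g x))\<^sup>2)"
  using assms sq_integrable_scale[OF assms(2), of "-1"]
  by (simp add: hdist_def L2_add L2_scale L2_norm sq_integrable_diff)

lemma hsum_cong:
  assumes "\<And>j. j < n \<Longrightarrow> u j = v j"
  shows "hsum H u n = hsum H v n"
  using assms by (induction n) auto

lemma L2_sum:
  assumes "\<And>j. j < n \<Longrightarrow> f j \<in> sq_integrable M"
    and "\<And>j. j < n \<Longrightarrow> F j = L2_class M (f j)"
  shows "hsum (L2_space M) F n = L2_class M (\<lambda>x. \<Sum>j<n. f j x)"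
  using assms by (induction n) (simp_all add: L2_zero L2_add sq_integrable_sum)

text \<open>
  Completeness (Riesz--Fischer). Along a subsequence with \<open>\<parallel>f\<^bsub>k+1\<^esub> - f\<^bsub>k\<^esub>\<parallel>\<^sup>2 < 4\<^bsup>-k\<^esup>\<close>
  the series of the weighted squares \<open>2\<^sup>k \<bar>f\<^bsub>k+1\<^esub> - f\<^bsub>k\<^esub>\<bar>\<^sup>2\<close> has a finite integral, hence converges
  almost everywhere; so its terms are bounded and the differences decay geometrically.
  Fatou's lemma then turns pointwise convergence into convergence in norm.
\<close>

lemma sq_integrable_fast_Cauchy_AE_convergent:
  fixes f :: "nat \<Rightarrow> 'a \<Rightarrow> complex"
  assumes f: "\<And>k. f k \<in> sq_integrable M"
    and fast: "\<And>k. (LINT x|M. (cmod (f (Suc k) x - f k x))\<^sup>2) < (1/4) ^ k"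
  shows "AE x in M. convergent (\<lambda>k. f k x)"
proof -
  define u where "u k x = 2 ^ k * (cmod (f (Suc k) x - f k x))\<^sup>2" for k x
  have [measurable]: "f k \<in> borel_measurable M" for k
    using f by (rule sq_integrable_measurable)
  have [measurable]: "u k \<in> borel_measurable M" for k
    unfolding u_def by measurable
  have u_nonneg: "0 \<le> u k x" for k x
    by (simp add: u_def)
  have int: "integrable M (u k)" for k
    unfolding u_def using sq_integrable_diff[OF f f, THEN sq_integrable_integrable] by simp
  have "(\<integral>\<^sup>+x. ennreal (u k x) \<partial>M) \<le> ennreal ((1/2) ^ k)" for k
  proof -
    have "integral\<^sup>L M (u k) = 2 ^ k * (LINT x|M. (cmod (f (Suc k) x - f k x))\<^sup>2)"
      unfolding u_def by simp
    also have "\<dots> \<le> 2 ^ k * (1/4) ^ k"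
      using fast[of k] by (intro mult_left_mono) auto
    also have "\<dots> = (1/2) ^ k"
      by (simp flip: power_mult_distrib)
    finally show ?thesis
      using int u_nonneg by (simp add: nn_integral_eq_integral)
  qed
  then have "(\<Sum>k. \<integral>\<^sup>+x. ennreal (u k x) \<partial>M) \<le> (\<Sum>k. ennreal ((1/2) ^ k))"
    by (intro suminf_le) auto
  also have "\<dots> = ennreal (\<Sum>k. (1/2) ^ k)"
    by (rule suminf_ennreal2) auto
  also have "\<dots> < \<infinity>" by simp
  finally have "(\<integral>\<^sup>+x. (\<Sum>k. ennreal (u k x)) \<partial>M) \<noteq> \<infinity>"
    by (subst nn_integral_suminf) auto
  then have "AE x in M. (\<Sum>k. ennreal (u k x)) \<noteq> \<infinity>"
    by (intro nn_integral_PInf_AE) auto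
  then show ?thesis
  proof eventually_elim
    case (elim x)
    then have "summable (\<lambda>k. u k x)"
      using u_nonneg by (intro summable_suminf_not_top) auto
    then obtain C where C: "\<And>k. u k x \<le> C"
      using summable_imp_Bseq[of "\<lambda>k. u k x"] u_nonneg unfolding Bseq_def
      by (metis abs_of_nonneg real_norm_def)
    have le: "cmod (f (Suc k) x - f k x) \<le> sqrt C * (sqrt (1/2)) ^ k" for k
    proof -
      have "(cmod (f (Suc k) x - f k x))\<^sup>2 \<le> C * (1/2) ^ k"
        using C[of k] by (simp add: u_def field_simps)
      then have "cmod (f (Suc k) x - f k x) \<le> sqrt (C * (1/2) ^ k)"
        by (rule real_le_rsqrt)
      then show ?thesis
        by (simp add: real_sqrt_mult real_sqrt_power)
    qed
    have "summable (\<lambda>k. sqrt C * (sqrt (1/2)) ^ k)"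
      by (intro summable_mult summable_geometric) (simp add: real_sqrt_lt_1_iff)
    then have "summable (\<lambda>k. f (Suc k) x - f k x)"
      by (rule summable_comparison_test'[where N = 0]) (rule le)
    then have "convergent (\<lambda>n. f n x - f 0 x)"
      unfolding summable_iff_convergent sum_lessThan_telescope[of "\<lambda>k. f k x"] .
    then show ?case
      using convergent_add_const_right_iff[of "\<lambda>n. f n x" "- f 0 x"] by simp
  qed
qed

lemma L2_space_complete:
  assumes X: "\<And>n. X n \<in> hcarrier (L2_space M)"
    and Cauchy: "\<And>e. e > 0 \<Longrightarrow> \<exists>n0. \<forall>m\<ge>n0. \<forall>n\<ge>n0. hdist (L2_space M) (X m) (X n) < e"
  shows "\<exists>x\<in>hcarrier (L2_space M). (\<lambda>n. hdist (L2_space M) (X n) x) \<longlonglongrightarrow> 0"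
proof -
  have "\<forall>n. \<exists>f. f \<in> sq_integrable M \<and> X n = L2_class M f"
    using X by (meson L2_carrierE)
  then obtain f where f: "\<And>n. f n \<in> sq_integrable M" and Xf: "\<And>n. X n = L2_class M (f n)"
    by metis
  have [measurable]: "f k \<in> borel_measurable M" for k
    using f by (rule sq_integrable_measurable)
  define d where "d m n = (LINT x|M. (cmod (f m x - f n x))\<^sup>2)" for m n
  have d_nn: "(\<integral>\<^sup>+x. ennreal ((cmod (f m x - f n x))\<^sup>2) \<partial>M) = ennreal (d m n)" for m n
    unfolding d_def
    by (intro nn_integral_eq_integral sq_integrable_integrable[OF sq_integrable_diff] f) auto
  have d_Cauchy: "\<exists>n0. \<forall>m\<ge>n0. \<forall>n\<ge>n0. d m n < e" if "e > 0" for e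
    using Cauchy[of "sqrt e"] that by (simp add: Xf L2_dist[OF f f] d_def)
  then have "\<forall>k. \<exists>n0. \<forall>m\<ge>n0. \<forall>n\<ge>n0. d m n < (1/4) ^ k"
    by simp
  then obtain r where r: "\<And>k m n. m \<ge> r k \<Longrightarrow> n \<ge> r k \<Longrightarrow> d m n < (1/4) ^ k"
    by metis
  \<comment> \<open>Indices beyond every \<open>r i\<close> with \<open>i \<le> k\<close> and tending to infinity.\<close>
  define s where "s k = (\<Sum>i\<le>k. r i) + k" for k
  have s_ge: "r k \<le> s k" "k \<le> s k" for k
    using member_le_sum[of k "{..k}" r] by (auto simp: s_def)
  have "r k \<le> s (Suc k)" for k
    using s_ge(1)[of k] by (simp add: s_def)
  then have "AE x in M. convergent (\<lambda>k. f (s k) x)"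
    using s_ge f r by (intro sq_integrable_fast_Cauchy_AE_convergent) (auto simp: d_def[symmetric])
  define g where "g x = lim (\<lambda>k. f (s k) x)" for x
  have [measurable]: "g \<in> borel_measurable M"
    unfolding g_def by measurable
  have lim: "AE x in M. (\<lambda>k. f (s k) x) \<longlonglongrightarrow> g x"
    using \<open>AE x in M. convergent _\<close> by eventually_elim (simp add: g_def convergent_LIMSEQ_iff)
  have Fatou: "(\<integral>\<^sup>+x. ennreal ((cmod (f n x - g x))\<^sup>2) \<partial>M) \<le> ennreal e"
    if e: "\<forall>m\<ge>n0. d n m < e" for n n0 e
  proof -
    have "(\<integral>\<^sup>+x. ennreal ((cmod (f n x - g x))\<^sup>2) \<partial>M) =
        (\<integral>\<^sup>+x. liminf (\<lambda>k. ennreal ((cmod (f n x - f (s k) x))\<^sup>2)) \<partial>M)"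
    proof (rule nn_integral_cong_AE, use lim in eventually_elim)
      case (elim x)
      then have "(\<lambda>k. ennreal ((cmod (f n x - f (s k) x))\<^sup>2)) \<longlonglongrightarrow> ennreal ((cmod (f n x - g x))\<^sup>2)"
        by (intro tendsto_ennrealI tendsto_intros)
      then show ?case
        by (intro lim_imp_Liminf[symmetric]) auto
    qed
    also have "\<dots> \<le> liminf (\<lambda>k. ennreal (d n (s k)))"
      unfolding d_nn[symmetric] by (rule nn_integral_liminf) measurable
    also have "\<dots> \<le> liminf (\<lambda>k. ennreal e)"
    proof (rule Liminf_mono)
      show "\<forall>\<^sub>F k in sequentially. ennreal (d n (s k)) \<le> ennreal e"
        using eventually_ge_at_top[of n0]
      proof eventually_elim
        case (elim k)
        then show ?case
          using e s_ge(2)[of k] by (intro ennreal_leI less_imp_le) auto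
      qed
    qed
    also have "\<dots> = ennreal e"
      by (simp add: Liminf_const)
    finally show ?thesis .
  qed
  have g: "g \<in> sq_integrable M"
  proof -
    obtain n where "\<forall>m\<ge>n. d n m < 1"
      using d_Cauchy[of 1] by auto
    then have "(\<integral>\<^sup>+x. ennreal ((cmod (f n x - g x))\<^sup>2) \<partial>M) < \<infinity>"
      using Fatou[of n n 1] by (auto intro: le_less_trans)
    then have "(\<lambda>x. f n x - g x) \<in> sq_integrable M"
      by (simp add: sq_integrable_def integrable_iff_bounded)
    from sq_integrable_diff[OF f[of n] this] show ?thesis
      by simp
  qed
  have "(\<lambda>n. sqrt (LINT x|M. (cmod (f n x - g x))\<^sup>2)) \<longlonglongrightarrow> sqrt 0"
  proof (intro tendsto_real_sqrt LIMSEQ_I)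
    fix e :: real
    assume "e > 0"
    then obtain n0 where n0: "\<forall>m\<ge>n0. \<forall>n\<ge>n0. d m n < e / 2"
      using d_Cauchy[of "e / 2"] by auto
    have "norm ((LINT x|M. (cmod (f n x - g x))\<^sup>2) - 0) < e" if "n \<ge> n0" for n
    proof -
      have "ennreal (LINT x|M. (cmod (f n x - g x))\<^sup>2) \<le> ennreal (e / 2)"
        using Fatou[of n0 n "e / 2"] n0 that
          nn_integral_eq_integral[OF sq_integrable_integrable[OF sq_integrable_diff[OF f[of n] g]]]
        by simp
      moreover have "0 \<le> (LINT x|M. (cmod (f n x - g x))\<^sup>2)"
        by simp
      ultimately show ?thesis
        using \<open>e > 0\<close> by (simp add: ennreal_le_iff)
    qed
    then show "\<exists>no. \<forall>n\<ge>no. norm ((LINT x|M. (cmod (f n x - g x))\<^sup>2) - 0) < e"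
      by blast
  qed
  then have "(\<lambda>n. hdist (L2_space M) (X n) (L2_class M g)) \<longlonglongrightarrow> 0"
    by (simp add: Xf L2_dist[OF f g])
  then show ?thesis
    using L2_class_closed[OF g] by blast
qed

theorem complex_hilbert_space_L2: "complex_hilbert_space (L2_space M)"
proof (rule complex_hilbert_space.intro)
  fix F G K :: "('a \<Rightarrow> complex) set" and c d :: complex
  note L2_simps = L2_zero L2_add L2_scale L2_inner L2_inner_self
    sq_integrable_zero sq_integrable_add sq_integrable_scale
  show "hzero (L2_space M) \<in> hcarrier (L2_space M)"
    by (simp add: L2_zero L2_class_closed sq_integrable_zero)
  assume "F \<in> hcarrier (L2_space M)"
  then obtain f where f: "f \<in> sq_integrable M" "F = L2_class M f"
    by (rule L2_carrierE)
  have neg: "(\<lambda>x. - f x) \<in> sq_integrable M"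
    using sq_integrable_scale[OF f(1), of "-1"] by simp
  show "hscale (L2_space M) c F \<in> hcarrier (L2_space M)"
    using f by (simp add: L2_simps L2_class_closed)
  show "hadd (L2_space M) F (hzero (L2_space M)) = F"
    using f by (simp add: L2_simps)
  show "hadd (L2_space M) F (hscale (L2_space M) (-1) F) = hzero (L2_space M)"
    using f neg by (simp add: L2_simps)
  show "hscale (L2_space M) (c + d) F =
      hadd (L2_space M) (hscale (L2_space M) c F) (hscale (L2_space M) d F)"
    using f by (simp add: L2_simps distrib_right)
  show "hscale (L2_space M) c (hscale (L2_space M) d F) = hscale (L2_space M) (c * d) F"
    using f by (simp add: L2_simps mult.assoc)
  show "hscale (L2_space M) 1 F = F"
    using f by (simp add: L2_simps)
  show "0 \<le> Re (hinner (L2_space M) F F)"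
    using f by (simp add: L2_inner_self)
  show "F = hzero (L2_space M)" if "hinner (L2_space M) F F = 0"
  proof -
    have "(LINT x|M. (cmod (f x))\<^sup>2) = 0"
      using that f by (simp add: L2_inner_self)
    then have "AE x in M. (cmod (f x))\<^sup>2 = 0"
      using integral_nonneg_eq_0_iff_AE[OF sq_integrable_integrable[OF f(1)]] by simp
    then show ?thesis
      using f by (simp add: L2_zero L2_class_eq_iff sq_integrable_zero)
  qed
  assume "G \<in> hcarrier (L2_space M)"
  then obtain g where g: "g \<in> sq_integrable M" "G = L2_class M g"
    by (rule L2_carrierE)
  show "hadd (L2_space M) F G \<in> hcarrier (L2_space M)"
    using f g by (simp add: L2_simps L2_class_closed)
  show "hadd (L2_space M) F G = hadd (L2_space M) G F"
    using f g by (simp add: L2_simps add.commute)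
  show "hscale (L2_space M) c (hadd (L2_space M) F G) =
      hadd (L2_space M) (hscale (L2_space M) c F) (hscale (L2_space M) c G)"
    using f g by (simp add: L2_simps distrib_left)
  show "hinner (L2_space M) (hscale (L2_space M) c F) G = c * hinner (L2_space M) F G"
    using f g by (simp add: L2_simps mult.assoc)
  have "cnj (LINT x|M. g x * cnj (f x)) = (LINT x|M. cnj (g x * cnj (f x)))"
    by (rule Bochner_Integration.integral_cnj[symmetric])
  then show "hinner (L2_space M) F G = cnj (hinner (L2_space M) G F)"
    using f g by (simp add: L2_simps mult.commute)
  assume "K \<in> hcarrier (L2_space M)"
  then obtain k where k: "k \<in> sq_integrable M" "K = L2_class M k"
    by (rule L2_carrierE)
  show "hadd (L2_space M) (hadd (L2_space M) F G) K = hadd (L2_space M) F (hadd (L2_space M) G K)"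
    using f g k by (simp add: L2_simps add.assoc)
  show "hinner (L2_space M) (hadd (L2_space M) F G) K =
      hinner (L2_space M) F K + hinner (L2_space M) G K"
    using f g k by (simp add: L2_simps sq_integrable_mult_cnj distrib_right)
qed (rule L2_space_complete)

text \<open>Since inner products separate vectors, an adjoint on one vector is found by exhibiting it.\<close>

lemma (in complex_hilbert_space) hadjoint_eqI:
  assumes z: "z \<in> hcarrier H" and adj: "\<And>x. x \<in> hcarrier H \<Longrightarrow> hinner H (T x) y = hinner H x z"
  shows "hadjoint H T y = z"
  unfolding hadjoint_def
proof (rule the_equality)
  fix w
  assume w: "w \<in> hcarrier H \<and> (\<forall>x\<in>hcarrier H. hinner H (T x) y = hinner H x w)"
  then have eq: "hinner H w x = hinner H z x" if "x \<in> hcarrier H" for x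
    using adj z that by (metis inner_commute)
  let ?v = "hadd H w (hscale H (-1) z)"
  have v: "?v \<in> hcarrier H"
    using w z by (simp add: add_closed scale_closed)
  have "hinner H ?v ?v = hinner H w ?v - hinner H z ?v"
    using w z v by (simp add: inner_add_left inner_scale_left scale_closed)
  also have "\<dots> = 0"
    using eq v by simp
  finally have v0: "?v = hzero H"
    using v inner_definite by blast
  have "w = hadd H w (hadd H z (hscale H (-1) z))"
    using w z by (simp add: add_inverse add_zero)
  also have "\<dots> = hadd H ?v z"
    using w z by (metis add_assoc add_commute scale_closed)
  also have "\<dots> = z"
    using v0 z by (metis add_commute add_zero zero_closed)
  finally show "w = z" .
qed (use assms in auto)

section \<open>Hausdorff measures under similarities\<close>

lemma powr_reciprocal_cancel:
  assumes "r > 0"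
  shows "ennreal (r powr s) * (ennreal ((1 / r) powr s) * t) = t"
    and "ennreal ((1 / r) powr s) * (ennreal (r powr s) * t) = t"
proof -
  have "ennreal (r powr s) * ennreal ((1 / r) powr s) = ennreal (r powr s * (1 / r) powr s)"
    by (rule ennreal_mult[symmetric]) auto
  also have "\<dots> = ennreal ((r * (1 / r)) powr s)"
    using assms by (subst powr_mult) auto
  finally have unit: "ennreal (r powr s) * ennreal ((1 / r) powr s) = 1"
    using assms by simp
  show "ennreal (r powr s) * (ennreal ((1 / r) powr s) * t) = t"
    by (simp only: mult.assoc[symmetric] unit mult_1)
  show "ennreal ((1 / r) powr s) * (ennreal (r powr s) * t) = t"
    by (simp only: mult.assoc[symmetric] unit mult_1 mult.commute[of "ennreal ((1 / r) powr s)"])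
qed

lemma similarity_inj:
  assumes h: "\<And>x y. dist (h x) (h y) = r * dist x y" and "r > 0"
  shows "inj h"
proof (rule injI)
  fix x y
  assume "h x = h y"
  then have "r * dist x y = 0"
    using h[of x y] by simp
  then show "x = y"
    using \<open>r > 0\<close> by simp
qed

lemma bounded_similarity_image:
  assumes h: "\<And>x y. dist (h x) (h y) = r * dist x y" and "r > 0" and "bounded S"
  shows "bounded (h ` S)"
proof -
  obtain x e where "\<forall>y\<in>S. dist x y \<le> e"
    using \<open>bounded S\<close> by (auto simp: bounded_def)
  then have "\<forall>y\<in>S. dist (h x) (h y) \<le> r * e"
    using \<open>r > 0\<close> by (simp add: h)
  then show ?thesis
    by (auto simp: bounded_def)
qed

lemma diameter_similarity_image:
  assumes h: "\<And>x y. dist (h x) (h y) = r * dist x y" and "r > 0" and "bounded S"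
  shows "diameter (h ` S) = r * diameter S"
proof (cases "S = {}")
  case False
  show ?thesis
  proof (rule antisym)
    show "diameter (h ` S) \<le> r * diameter S"
      using False \<open>r > 0\<close> diameter_bounded_bound[OF \<open>bounded S\<close>]
      by (auto simp: diameter_def[of "h ` S"] h intro!: cSUP_least)
    have "dist x y \<le> diameter (h ` S) / r" if "x \<in> S" "y \<in> S" for x y
      using diameter_bounded_bound[OF bounded_similarity_image[OF assms], of "h x" "h y"] that \<open>r > 0\<close>
      by (simp add: h field_simps)
    then have "diameter S \<le> diameter (h ` S) / r"
      using False by (auto simp: diameter_def[of S] intro!: cSUP_least)
    then show "r * diameter S \<le> diameter (h ` S)"
      using \<open>r > 0\<close> by (simp add: field_simps)
  qed
qed simp

lemma hausdorff_gauge_similarity_image: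
  assumes h: "\<And>x y. dist (h x) (h y) = r * dist x y" and "r > 0" and "bounded S"
  shows "hausdorff_gauge s (h ` S) = ennreal (r powr s) * hausdorff_gauge s S"
  using \<open>r > 0\<close> diameter_ge_0[OF \<open>bounded S\<close>]
  by (simp add: hausdorff_gauge_def diameter_similarity_image[OF assms] powr_mult ennreal_mult)

lemma hausdorff_premeasure_similarity_image_le:
  assumes h: "\<And>x y. dist (h x) (h y) = r * dist x y" and "r > 0"
  shows "hausdorff_premeasure s (r * \<epsilon>) (h ` E) \<le> ennreal (r powr s) * hausdorff_premeasure s \<epsilon> E"
proof -
  define C where "C = {U :: nat \<Rightarrow> _ set. E \<subseteq> (\<Union>n. U n) \<and> (\<forall>n. bounded (U n) \<and> diameter (U n) \<le> \<epsilon>)}"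
  have "ennreal ((1 / r) powr s) * hausdorff_premeasure s (r * \<epsilon>) (h ` E) \<le> (\<Sum>n. hausdorff_gauge s (U n))"
    if "U \<in> C" for U
  proof -
    have U: "bounded (U n)" "diameter (U n) \<le> \<epsilon>" "E \<subseteq> (\<Union>n. U n)" for n
      using that by (auto simp: C_def)
    have "h ` E \<subseteq> (\<Union>n. h ` U n)"
      using U(3) by (simp add: image_mono flip: image_UN)
    then have "hausdorff_premeasure s (r * \<epsilon>) (h ` E) \<le> (\<Sum>n. hausdorff_gauge s (h ` U n))"
      unfolding hausdorff_premeasure_def
      using U \<open>r > 0\<close>
      by (intro INF_lower2[where i = "\<lambda>n. h ` U n"])
        (auto intro: bounded_similarity_image[OF h] simp: diameter_similarity_image[OF h])
    also have "\<dots> = ennreal (r powr s) * (\<Sum>n. hausdorff_gauge s (U n))"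
      by (simp add: hausdorff_gauge_similarity_image[OF h \<open>r > 0\<close> U(1)])
    finally have "ennreal ((1 / r) powr s) * hausdorff_premeasure s (r * \<epsilon>) (h ` E) \<le>
        ennreal ((1 / r) powr s) * (ennreal (r powr s) * (\<Sum>n. hausdorff_gauge s (U n)))"
      by (rule mult_left_mono) simp
    then show ?thesis
      by (simp only: powr_reciprocal_cancel[OF \<open>r > 0\<close>])
  qed
  then have "ennreal ((1 / r) powr s) * hausdorff_premeasure s (r * \<epsilon>) (h ` E) \<le>
      hausdorff_premeasure s \<epsilon> E"
    unfolding hausdorff_premeasure_def[of s \<epsilon> E] C_def[symmetric] by (rule INF_greatest)
  then have "ennreal (r powr s) * (ennreal ((1 / r) powr s) * hausdorff_premeasure s (r * \<epsilon>) (h ` E)) \<le>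
      ennreal (r powr s) * hausdorff_premeasure s \<epsilon> E"
    by (rule mult_left_mono) simp
  then show ?thesis
    by (simp only: powr_reciprocal_cancel[OF \<open>r > 0\<close>])
qed

lemma hausdorff_outer_similarity_image_le:
  assumes h: "\<And>x y. dist (h x) (h y) = r * dist x y" and "r > 0"
  shows "hausdorff_outer s (h ` E) \<le> ennreal (r powr s) * hausdorff_outer s E"
  unfolding hausdorff_outer_def[of s "h ` E"]
proof (rule SUP_least)
  fix \<epsilon> :: real
  assume "\<epsilon> \<in> {0<..}"
  then have "hausdorff_premeasure s (\<epsilon> / r) E \<le> hausdorff_outer s E"
    using \<open>r > 0\<close> by (auto simp: hausdorff_outer_def intro!: SUP_upper)
  then have "ennreal (r powr s) * hausdorff_premeasure s (\<epsilon> / r) E \<le>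
      ennreal (r powr s) * hausdorff_outer s E"
    by (rule mult_left_mono) simp
  then show "hausdorff_premeasure s \<epsilon> (h ` E) \<le> ennreal (r powr s) * hausdorff_outer s E"
    using hausdorff_premeasure_similarity_image_le[OF assms, of s "\<epsilon> / r" E] \<open>r > 0\<close> by simp
qed

lemma hausdorff_outer_similarity_image:
  assumes h: "\<And>x y. dist (h x) (h y) = r * dist x y" and "r > 0" and "surj h"
  shows "hausdorff_outer s (h ` E) = ennreal (r powr s) * hausdorff_outer s E"
proof (rule antisym)
  have "inj h"
    using h \<open>r > 0\<close> by (rule similarity_inj)
  have "dist (inv h x) (inv h y) = (1 / r) * dist x y" for x y
    using h[of "inv h x" "inv h y"] \<open>surj h\<close> \<open>r > 0\<close> by (simp add: surj_f_inv_f)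
  then have "hausdorff_outer s (inv h ` h ` E) \<le> ennreal ((1 / r) powr s) * hausdorff_outer s (h ` E)"
    using \<open>r > 0\<close> by (intro hausdorff_outer_similarity_image_le) auto
  then have "ennreal (r powr s) * hausdorff_outer s E \<le>
      ennreal (r powr s) * (ennreal ((1 / r) powr s) * hausdorff_outer s (h ` E))"
    using \<open>inj h\<close> by (intro mult_left_mono) (auto simp: image_inv_f_f)
  also have "\<dots> = hausdorff_outer s (h ` E)"
    by (rule powr_reciprocal_cancel[OF \<open>r > 0\<close>])
  finally show "ennreal (r powr s) * hausdorff_outer s E \<le> hausdorff_outer s (h ` E)" .
qed (rule hausdorff_outer_similarity_image_le[OF assms(1,2)])

lemma space_hausdorff_measure [simp]: "space (hausdorff_measure s) = UNIV"
  by (simp add: hausdorff_measure_def)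

lemma sets_hausdorff_measure [simp, measurable_cong]: "sets (hausdorff_measure s) = sets borel"
  using sets.sigma_sets_eq[of borel] by (simp add: hausdorff_measure_def)

text \<open>
  A measure given by a set function takes its values from that function if the function is
  countably additive, and vanishes identically otherwise. The scaling law holds in either case,
  so that it needs no Caratheodory construction.
\<close>

lemma emeasure_hausdorff_measure_similarity_image:
  fixes h :: "'a::metric_space \<Rightarrow> 'a"
  assumes h: "\<And>x y. dist (h x) (h y) = r * dist x y" and "r > 0" and "surj h"
    and "E \<in> sets borel" "h ` E \<in> sets borel"
  shows "emeasure (hausdorff_measure s) (h ` E) = ennreal (r powr s) * emeasure (hausdorff_measure s) E"
  using assms(4,5) hausdorff_outer_similarity_image[OF assms(1-3)]
  by (auto simp: hausdorff_measure_def emeasure_measure_of_conv)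

text \<open>
  Change of variables without any measurability assumption on the integrand \<open>F\<close>; the integral of
  a non-measurable function is the supremum of the integrals of the simple functions below it.
\<close>

lemma nn_integral_scaled_le:
  assumes T: "T \<in> measurable M M'"
    and scaled: "\<And>E. E \<in> sets M' \<Longrightarrow> emeasure M (T -` E \<inter> space M) = c * emeasure M' E"
  shows "c * (\<integral>\<^sup>+y. F y \<partial>M') \<le> (\<integral>\<^sup>+x. F (T x) \<partial>M)"
proof -
  have distr: "distr M M' T = scale_measure c M'"
    using T scaled by (intro measure_eqI) (auto simp: emeasure_distr)
  have "c * integral\<^sup>S M' g \<le> (\<integral>\<^sup>+x. F (T x) \<partial>M)" if g: "simple_function M' g" "g \<le> F" for g
  proof -
    have [measurable]: "g \<in> borel_measurable M'"
      using g(1) by (rule borel_measurable_simple_function)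
    have "c * integral\<^sup>S M' g = (\<integral>\<^sup>+y. g y \<partial>scale_measure c M')"
      using g(1) by (simp add: nn_integral_eq_simple_integral nn_integral_scale_measure)
    also have "\<dots> = (\<integral>\<^sup>+x. g (T x) \<partial>M)"
      using T by (simp flip: distr add: nn_integral_distr)
    also have "\<dots> \<le> (\<integral>\<^sup>+x. F (T x) \<partial>M)"
      using g(2) by (intro nn_integral_mono) (simp add: le_fun_def)
    finally show ?thesis .
  qed
  then show ?thesis
    by (auto simp: nn_integral_def[of M'] SUP_mult_left_ennreal intro!: SUP_least)
qed

lemma nn_integral_hausdorff_similarity:
  fixes h :: "'a::metric_space \<Rightarrow> 'a" and F :: "'a \<Rightarrow> ennreal"
  assumes h: "\<And>x y. dist (h x) (h y) = r * dist x y" and "r > 0" and "surj h"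
  shows "(\<integral>\<^sup>+y. F y \<partial>hausdorff_measure s) =
    ennreal (r powr s) * (\<integral>\<^sup>+y. F (h y) \<partial>hausdorff_measure s)"
proof (rule antisym)
  let ?H = "hausdorff_measure s :: 'a measure"
  have inv: "inv h (h x) = x" "h (inv h x) = x" for x
    using similarity_inj[OF h \<open>r > 0\<close>] \<open>surj h\<close> by (simp_all add: surj_f_inv_f)
  have "continuous_on UNIV h"
    using \<open>r > 0\<close> h by (intro lipschitz_on_continuous_on[of r] lipschitz_onI) auto
  then have h_meas: "h \<in> measurable ?H ?H"
    using borel_measurable_continuous_onI by (simp cong: measurable_cong_sets)
  have "dist (inv h x) (inv h y) = (1 / r) * dist x y" for x y
    using h[of "inv h x" "inv h y"] \<open>r > 0\<close> by (simp add: inv)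
  then have "continuous_on UNIV (inv h)"
    using \<open>r > 0\<close> by (intro lipschitz_on_continuous_on[of "1 / r"] lipschitz_onI) auto
  then have inv_meas: "inv h \<in> measurable ?H ?H"
    using borel_measurable_continuous_onI by (simp cong: measurable_cong_sets)
  have image: "h ` E = inv h -` E" for E
    using bij_vimage_eq_inv_image[OF bij_imp_bij_inv[of h]] similarity_inj[OF h \<open>r > 0\<close>] \<open>surj h\<close>
    by (simp add: bij_def inv_inv_eq)
  have scaled: "emeasure ?H (inv h -` E) = ennreal (r powr s) * emeasure ?H E" if "E \<in> sets borel" for E
    using emeasure_hausdorff_measure_similarity_image[OF h \<open>r > 0\<close> \<open>surj h\<close> that]
      measurable_sets[OF inv_meas, of E] that by (simp add: image)
  then have "ennreal (r powr s) * (\<integral>\<^sup>+y. F (h y) \<partial>?H) \<le> (\<integral>\<^sup>+x. F (h (inv h x)) \<partial>?H)"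
    by (intro nn_integral_scaled_le[OF inv_meas]) simp
  then show "ennreal (r powr s) * (\<integral>\<^sup>+y. F (h y) \<partial>?H) \<le> (\<integral>\<^sup>+y. F y \<partial>?H)"
    by (simp add: inv)
  have "emeasure ?H (h -` E) = ennreal ((1 / r) powr s) * emeasure ?H E" if "E \<in> sets borel" for E
  proof -
    have "inv h -` h -` E = E"
      by (auto simp: inv)
    then have "emeasure ?H E = ennreal (r powr s) * emeasure ?H (h -` E)"
      using scaled[of "h -` E"] measurable_sets[OF h_meas, of E] that by simp
    then show ?thesis
      by (simp only: powr_reciprocal_cancel[OF \<open>r > 0\<close>])
  qed
  then have "ennreal ((1 / r) powr s) * (\<integral>\<^sup>+y. F y \<partial>?H) \<le> (\<integral>\<^sup>+x. F (h x) \<partial>?H)"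
    by (intro nn_integral_scaled_le[OF h_meas]) simp
  then have "ennreal (r powr s) * (ennreal ((1 / r) powr s) * (\<integral>\<^sup>+y. F y \<partial>?H)) \<le>
      ennreal (r powr s) * (\<integral>\<^sup>+x. F (h x) \<partial>?H)"
    by (rule mult_left_mono) simp
  then show "(\<integral>\<^sup>+y. F y \<partial>?H) \<le> ennreal (r powr s) * (\<integral>\<^sup>+y. F (h y) \<partial>?H)"
    by (simp only: powr_reciprocal_cancel[OF \<open>r > 0\<close>])
qed

section \<open>The measure on the sequence space and the prepending maps\<close>

lemma space_mu [simp]: "space (mu N A) = Lam N A"
  by (auto simp: mu_def space_measure_of_conv)

lemma sets_mu [measurable_cong]: "sets (mu N A) = sets (restrict_space borel (Lam N A))"
proof -
  have "sigma_sets (Lam N A) (sets (restrict_space borel (Lam N A))) = sets (restrict_space borel (Lam N A))"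
    using sets.sigma_sets_eq[of "restrict_space borel (Lam N A)"] by (simp add: space_restrict_space)
  moreover have "sets (restrict_space borel (Lam N A)) \<subseteq> Pow (Lam N A)"
    using sets.sets_into_space[of _ "restrict_space borel (Lam N A)"] by (auto simp: space_restrict_space)
  ultimately show ?thesis
    by (simp add: mu_def)
qed

text \<open>
  The integral over the fibres that defines \<^const>\<open>mu\<close>. It is considered for all sets \<open>B\<close>, also
  for those where the integrand is not known to be measurable.
\<close>

definition fibre_integral :: "nat \<Rightarrow> (nat \<Rightarrow> nat \<Rightarrow> nat) \<Rightarrow> (nat \<Rightarrow> nat) set \<Rightarrow> ennreal" where
  "fibre_integral N A B = set_nn_integral (hausdorff_measure (delta N A)) {0..1}
     (\<lambda>y. emeasure (count_space UNIV) {w \<in> B. seq_val N w = y})"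

text \<open>
  As for the Hausdorff measure, both alternatives are compatible with a scaling law, so there is no
  need to decide between them.
\<close>

lemma emeasure_mu_cases:
  "(\<forall>B\<in>sets (mu N A). emeasure (mu N A) B = fibre_integral N A B) \<or>
   (\<forall>B\<in>sets (mu N A). emeasure (mu N A) B = 0)"
proof -
  have "sigma_sets (Lam N A) (sets (restrict_space borel (Lam N A))) = sets (mu N A)"
    using sets.sigma_sets_eq[of "restrict_space borel (Lam N A)"]
    by (simp add: space_restrict_space sets_mu)
  then show ?thesis
    unfolding mu_def[of N A] fibre_integral_def[symmetric]
    by (auto simp: emeasure_measure_of_conv sets_mu[unfolded mu_def fibre_integral_def[symmetric]])
qed

lemma prepend_0 [simp]: "prepend i x 0 = i"
  and prepend_Suc [simp]: "prepend i x (Suc k) = x k"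
  by (simp_all add: prepend_def)

lemma shift_prepend [simp]: "shift (prepend i x) = x"
  by (simp add: shift_def)

lemma prepend_shift: "prepend (x 0) (shift x) = x"
  by (rule ext) (simp add: shift_def prepend_def split: nat.split)

lemma inj_prepend: "inj (prepend i)"
  by (metis injI shift_prepend)

lemma Dset_subset: "Dset N A i \<subseteq> Lam N A"
  by (auto simp: Dset_def)

lemma Rset_subset: "Rset N A i \<subseteq> Lam N A"
  by (auto simp: Rset_def)

lemma shift_Lam: "x \<in> Lam N A \<Longrightarrow> shift x \<in> Lam N A"
  by (simp add: Lam_def shift_def)

lemma shift_Rset: "x \<in> Rset N A i \<Longrightarrow> shift x \<in> Dset N A i"
  by (auto simp: Rset_def Dset_def shift_Lam) (auto simp: Lam_def shift_def)

lemma prepend_shift_Rset: "x \<in> Rset N A i \<Longrightarrow> prepend i (shift x) = x"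
  using prepend_shift[of x] by (auto simp: Rset_def)

lemma prepend_Dset:
  assumes "x \<in> Dset N A i" "i < N"
  shows "prepend i x \<in> Rset N A i"
proof -
  have "prepend i x k < N \<and> A (prepend i x k) (prepend i x (Suc k)) = 1" for k
    using assms by (cases k) (auto simp: Dset_def Lam_def)
  then show ?thesis
    by (simp add: Rset_def Lam_def)
qed

lemma prepend_image_eq:
  assumes "B \<subseteq> Dset N A i" "i < N"
  shows "prepend i ` B = {x \<in> Rset N A i. shift x \<in> B}"
proof (intro equalityI subsetI)
  fix x
  assume "x \<in> {x \<in> Rset N A i. shift x \<in> B}"
  then show "x \<in> prepend i ` B"
    using prepend_shift_Rset[of x N A i] by (intro image_eqI[of _ _ "shift x"]) auto
qed (use assms prepend_Dset in auto)

lemma coordinate_measurable [measurable]: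
  "(\<lambda>x :: nat \<Rightarrow> nat. x k) \<in> measurable borel (count_space UNIV)"
proof -
  have "(\<lambda>x :: nat \<Rightarrow> nat. x k) \<in> measurable borel borel"
    by (rule measurable_product_coordinates)
  then show ?thesis
    using measurable_cong_sets[OF refl sets_borel_eq_count_space[where 'a = nat], of borel] by blast
qed

lemma Dset_sets [measurable]: "Dset N A i \<in> sets (mu N A)"
proof -
  have "Dset N A i = Lam N A \<inter> {x \<in> space borel. A i (x 0) = 1}"
    by (auto simp: Dset_def)
  moreover have "{x \<in> space borel. A i (x (0::nat)) = 1} \<in> sets borel"
    by measurable
  ultimately show ?thesis
    by (auto simp: sets_mu sets_restrict_space)
qed

lemma Rset_sets [measurable]: "Rset N A i \<in> sets (mu N A)"
proof -
  have "Rset N A i = Lam N A \<inter> {x \<in> space borel. x 0 = i}"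
    by (auto simp: Rset_def)
  moreover have "{x \<in> space borel. x (0::nat) = i} \<in> sets borel"
    by measurable
  ultimately show ?thesis
    by (auto simp: sets_mu sets_restrict_space)
qed

lemma shift_measurable [measurable]: "shift \<in> measurable (mu N A) (mu N A)"
proof -
  have "shift \<in> measurable borel borel"
    unfolding shift_def by (intro measurable_coordinatewise_then_product) measurable
  then have "shift \<in> measurable (restrict_space borel (Lam N A)) (restrict_space borel (Lam N A))"
    by (intro measurable_restrict_space2 measurable_restrict_space1)
      (auto simp: space_restrict_space shift_Lam)
  then show ?thesis
    by (simp cong: measurable_cong_sets add: sets_mu)
qed

text \<open>
  The partial map \<open>\<sigma>\<^sub>i\<close> from \<open>D\<^sub>i\<close> to \<open>R\<^sub>i\<close>, extended by the identity outside \<open>D\<^sub>i\<close> so that it maps the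
  sequence space to itself.
\<close>

definition prepend_total ::
  "nat \<Rightarrow> (nat \<Rightarrow> nat \<Rightarrow> nat) \<Rightarrow> nat \<Rightarrow> (nat \<Rightarrow> nat) \<Rightarrow> nat \<Rightarrow> nat" where
  "prepend_total N A i x = (if x \<in> Dset N A i then prepend i x else x)"

lemma prepend_total_measurable:
  assumes "i < N"
  shows "prepend_total N A i \<in> measurable (mu N A) (mu N A)"
proof -
  have "(\<lambda>x. prepend i x k) \<in> borel_measurable borel" for k
    by (cases k) (auto intro!: measurable_product_coordinates)
  then have "prepend i \<in> measurable borel borel"
    by (intro measurable_coordinatewise_then_product)
  then have "prepend i \<in> measurable (mu N A) borel"
    by (simp add: measurable_restrict_space1 cong: measurable_cong_sets add: sets_mu)
  moreover have "(\<lambda>x. x) \<in> measurable (mu N A) borel"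
    by (simp add: measurable_restrict_space1 cong: measurable_cong_sets add: sets_mu)
  ultimately have "prepend_total N A i \<in> measurable (mu N A) borel"
    unfolding prepend_total_def
    by (intro measurable_If_set) (auto simp: Int_absorb2 Dset_subset)
  moreover have "prepend_total N A i x \<in> Lam N A" if "x \<in> Lam N A" for x
    using that prepend_Dset[OF _ assms, of x A] Rset_subset[of N A i] by (auto simp: prepend_total_def)
  ultimately have "prepend_total N A i \<in> measurable (mu N A) (restrict_space borel (Lam N A))"
    by (intro measurable_restrict_space2) auto
  then show ?thesis
    by (simp cong: measurable_cong_sets add: sets_mu)
qed

lemma prepend_total_shift: "x \<in> Rset N A i \<Longrightarrow> prepend_total N A i (shift x) = x"
  by (simp add: prepend_total_def shift_Rset prepend_shift_Rset)

text \<open>A 0-1 matrix of transitions; as in the definition of \<open>\<Lambda>\<^sub>A\<close>, only entries with indices below \<open>N\<close> matter.\<close>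

locale transition_matrix =
  fixes N :: nat and A :: "nat \<Rightarrow> nat \<Rightarrow> nat"
  assumes N_ge_2: "N \<ge> 2"
    and zero_one: "\<And>i j. i < N \<Longrightarrow> j < N \<Longrightarrow> A i j \<in> {0, 1}"
begin

lemma seq_val_sums:
  assumes "w \<in> Lam N A"
  shows "(\<lambda>k. real (w k) / real N ^ Suc k) sums seq_val N w"
    and "0 \<le> seq_val N w" and "seq_val N w \<le> 1"
proof -
  let ?g = "\<lambda>k. real (N - 1) / real N * (1 / real N) ^ k"
  have g: "?g sums (real (N - 1) / real N * (1 / (1 - 1 / real N)))"
    using N_ge_2 by (intro sums_mult geometric_sums) auto
  have le: "real (w k) / real N ^ Suc k \<le> ?g k" for k
  proof -
    have "real (w k) \<le> real (N - 1)"
      using assms by (auto simp: Lam_def intro!: Nat.le_diff_conv2[THEN iffD2] Suc_leI)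
    then have "real (w k) / real N ^ Suc k \<le> real (N - 1) / real N ^ Suc k"
      by (rule divide_right_mono) simp
    then show ?thesis
      by (simp add: power_one_over)
  qed
  have "summable (\<lambda>k. real (w k) / real N ^ Suc k)"
    using le by (intro summable_comparison_test'[OF sums_summable[OF g], of 0]) auto
  then show sums: "(\<lambda>k. real (w k) / real N ^ Suc k) sums seq_val N w"
    unfolding seq_val_def by (rule summable_sums)
  show "0 \<le> seq_val N w"
    by (rule sums_le[OF _ sums_zero sums]) simp
  have "seq_val N w \<le> real (N - 1) / real N * (1 / (1 - 1 / real N))"
    by (rule sums_le[OF _ sums g]) (rule le)
  also have "\<dots> = 1"
    using N_ge_2 by (simp add: field_simps of_nat_diff)
  finally show "seq_val N w \<le> 1" .
qed

lemma seq_val_prepend: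
  assumes "w \<in> Lam N A"
  shows "seq_val N (prepend i w) = (real i + seq_val N w) / real N"
proof -
  have "(\<lambda>k. 1 / real N * (real (w k) / real N ^ Suc k)) sums (1 / real N * seq_val N w)"
    by (intro sums_mult seq_val_sums assms)
  then have "(\<lambda>k. real (prepend i w (Suc k)) / real N ^ Suc (Suc k)) sums (1 / real N * seq_val N w)"
    by simp
  from sums_Suc[OF this] show ?thesis
    unfolding seq_val_def[of N "prepend i w"]
    by (simp add: sums_iff add_divide_distrib)
qed

lemma fibre_integral_eq:
  assumes "B \<subseteq> Lam N A"
  shows "fibre_integral N A B =
    (\<integral>\<^sup>+y. emeasure (count_space UNIV) {w \<in> B. seq_val N w = y} \<partial>hausdorff_measure (delta N A))"
proof -
  have "emeasure (count_space UNIV) {w \<in> B. seq_val N w = y} * indicator {0..1} y =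
      emeasure (count_space UNIV) {w \<in> B. seq_val N w = y}" for y
  proof (cases "y \<in> {0..1}")
    case False
    then have "{w \<in> B. seq_val N w = y} = {}"
      using assms seq_val_sums(2,3) by fastforce
    then show ?thesis
      by (simp only: emeasure_empty mult_zero_left)
  qed simp
  then show ?thesis
    by (simp add: fibre_integral_def)
qed

text \<open>The constant \<open>N\<^bsup>-\<delta>\<^esup>\<close> by which every \<open>\<sigma>\<^sub>i\<close> scales the measure.\<close>

definition ratio :: real where
  "ratio = (1 / real N) powr delta N A"

lemma ratio_pos: "ratio > 0"
  using N_ge_2 by (simp add: ratio_def)

lemma fibre_integral_prepend:
  assumes "B \<subseteq> Dset N A i" "i < N"
  shows "fibre_integral N A (prepend i ` B) = ennreal ratio * fibre_integral N A B"
proof -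
  define h where "h y = (real i + y) / real N" for y
  have B: "B \<subseteq> Lam N A" "prepend i ` B \<subseteq> Lam N A"
    using assms Dset_subset Rset_subset prepend_Dset by (blast, blast)
  have h_inj: "h x = h y \<longleftrightarrow> x = y" for x y
    using N_ge_2 by (simp add: h_def)
  have dist: "dist (h x) (h y) = (1 / real N) * dist x y" for x y
    by (simp add: h_def dist_real_def diff_divide_distrib[symmetric] abs_divide)
  have surj: "surj h"
    using N_ge_2 by (intro surjI[of _ "\<lambda>y. real N * y - real i"]) (simp add: h_def)
  have fibre: "emeasure (count_space UNIV) {w \<in> prepend i ` B. seq_val N w = h y} =
      emeasure (count_space UNIV) {w \<in> B. seq_val N w = y}" for y
  proof -
    have "{w \<in> prepend i ` B. seq_val N w = h y} = prepend i ` {w \<in> B. seq_val N w = y}"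
      using B(1) by (auto simp: seq_val_prepend h_inj subset_iff simp flip: h_def)
    moreover have "inj_on (prepend i) {w \<in> B. seq_val N w = y}"
      using inj_prepend subset_UNIV by (rule inj_on_subset)
    ultimately show ?thesis
      by (simp add: emeasure_count_space finite_image_iff card_image)
  qed
  have "fibre_integral N A (prepend i ` B) =
      (\<integral>\<^sup>+y. emeasure (count_space UNIV) {w \<in> prepend i ` B. seq_val N w = y}
        \<partial>hausdorff_measure (delta N A))"
    by (rule fibre_integral_eq[OF B(2)])
  also have "\<dots> = ennreal ratio *
      (\<integral>\<^sup>+y. emeasure (count_space UNIV) {w \<in> prepend i ` B. seq_val N w = h y}
        \<partial>hausdorff_measure (delta N A))"
    unfolding ratio_def using N_ge_2 by (intro nn_integral_hausdorff_similarity dist surj) simp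
  also have "\<dots> = ennreal ratio * fibre_integral N A B"
    by (simp add: fibre fibre_integral_eq[OF B(1)])
  finally show ?thesis .
qed

lemma prepend_image_sets:
  assumes "B \<in> sets (mu N A)" "B \<subseteq> Dset N A i" "i < N"
  shows "prepend i ` B \<in> sets (mu N A)"
proof -
  have "prepend i ` B = Rset N A i \<inter> (shift -` B \<inter> space (mu N A))"
    using Rset_subset by (auto simp: prepend_image_eq[OF assms(2,3)])
  moreover have "shift -` B \<inter> space (mu N A) \<in> sets (mu N A)"
    using shift_measurable assms(1) by (rule measurable_sets)
  ultimately show ?thesis
    by (metis Rset_sets sets.Int)
qed

theorem emeasure_mu_prepend:
  assumes "B \<in> sets (mu N A)" "B \<subseteq> Dset N A i" "i < N"
  shows "emeasure (mu N A) (prepend i ` B) = ennreal ratio * emeasure (mu N A) B"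
  using emeasure_mu_cases[of N A] prepend_image_sets[OF assms] assms(1)
  by (auto simp: fibre_integral_prepend[OF assms(2,3)])

end

section \<open>Radon--Nikodym derivatives without \<open>\<sigma>\<close>-finiteness\<close>

text \<open>
  Densities are unique almost everywhere only on a \<open>\<sigma>\<close>-finite part of the space. The set where a
  square-integrable function does not vanish is such a part: it is exhausted by the sets
  \<open>{\<bar>\<psi>\<bar>\<^sup>2 \<ge> 1/(n+1)}\<close>, which have finite measure.
\<close>

lemma AE_density_const_unique:
  fixes \<psi> :: "'a \<Rightarrow> complex"
  assumes f [measurable]: "f \<in> borel_measurable M"
    and dens: "density M f = density M (\<lambda>_. ennreal c)"
    and \<psi>: "\<psi> \<in> sq_integrable M"
  shows "AE x in M. \<psi> x \<noteq> 0 \<longrightarrow> f x = ennreal c"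
proof -
  have [measurable]: "\<psi> \<in> borel_measurable M"
    using \<psi> by (rule sq_integrable_measurable)
  define S where "S n = {x \<in> space M. 1 / real (Suc n) \<le> (cmod (\<psi> x))\<^sup>2}" for n
  have [measurable]: "S n \<in> sets M" for n
    unfolding S_def by measurable
  have "AE x in M. f x * indicator (S n) x = ennreal c * indicator (S n) x" for n
  proof -
    have restrict: "density M (\<lambda>x. g x * indicator (S n) x) = density (density M g) (indicator (S n))"
      if "g \<in> borel_measurable M" for g
      using that by (simp add: density_density_eq)
    have "emeasure M (S n) \<le> ennreal (1 / (1 / real (Suc n)) * (LINT x|M. (cmod (\<psi> x))\<^sup>2))"
      unfolding S_def
      by (rule integral_Markov_inequality[OF sq_integrable_integrable[OF \<psi>]]) auto
    also have "\<dots> < \<infinity>"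
      by simp
    finally have "(\<integral>\<^sup>+x. ennreal c * indicator (S n) x \<partial>M) \<noteq> \<infinity>"
      by (simp add: nn_integral_cmult_indicator ennreal_mult_eq_top_iff)
    moreover have "density M (\<lambda>x. ennreal c * indicator (S n) x) = density M (\<lambda>x. f x * indicator (S n) x)"
      by (simp add: restrict dens)
    ultimately have "AE x in M. ennreal c * indicator (S n) x = f x * indicator (S n) x"
      by (subst (asm) finite_density_unique) auto
    then show ?thesis
      by eventually_elim simp
  qed
  then have "AE x in M. \<forall>n. f x * indicator (S n) x = ennreal c * indicator (S n) x"
    by (simp add: AE_all_countable)
  moreover have "AE x in M. x \<in> space M"
    by (rule AE_space)
  ultimately show ?thesis
  proof eventually_elim
    case (elim x)
    show ?case
    proof
      assume "\<psi> x \<noteq> 0"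
      then obtain n where "1 / real (Suc n) < (cmod (\<psi> x))\<^sup>2"
        using nat_approx_posE[of "(cmod (\<psi> x))\<^sup>2"] by auto
      then have "x \<in> S n"
        using elim(2) by (simp add: S_def)
      then show "f x = ennreal c"
        using elim(1)[rule_format, of n] by simp
    qed
  qed
qed

section \<open>The representation on \<open>L\<^sup>2\<close>\<close>

context transition_matrix
begin

text \<open>
  The measure \<open>\<mu> \<circ> \<sigma>\<^sub>i\<close> on \<open>D\<^sub>i\<close> is \<open>ratio\<close> times \<open>\<mu>\<close>; in particular the set function defining
  \<^const>\<open>mu_prepend\<close> is countably additive.
\<close>

lemma mu_prepend_eq_density:
  assumes "i < N"
  shows "mu_prepend N A i = density (restrict_space (mu N A) (Dset N A i)) (\<lambda>_. ennreal ratio)"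
    (is "_ = ?R")
proof -
  let ?D = "Dset N A i"
  have sp: "space ?R = ?D"
    using Dset_subset by (auto simp: space_restrict_space)
  have "mu_prepend N A i = measure_of (space ?R) (sets ?R) (\<lambda>B. emeasure (mu N A) (prepend i ` B))"
    by (simp only: mu_prepend_def sp sets_density)
  also have "\<dots> = measure_of (space ?R) (sets ?R) (emeasure ?R)"
  proof (rule measure_of_eq)
    show "sets ?R \<subseteq> Pow (space ?R)"
      by (rule sets.space_closed)
    fix B
    assume "B \<in> sigma_sets (space ?R) (sets ?R)"
    then have "B \<in> sets ?R"
      by (simp only: sets.sigma_sets_eq)
    then have B: "B \<in> sets (mu N A)" "B \<subseteq> ?D" "B \<in> sets (restrict_space (mu N A) ?D)"
      using Dset_subset by (auto simp: sets_restrict_space_iff Int_absorb2)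
    have "emeasure ?R B = ennreal ratio * emeasure (mu N A) B"
      using B Dset_subset by (simp add: emeasure_density nn_integral_cmult_indicator
          emeasure_restrict_space Int_absorb2)
    then show "emeasure (mu N A) (prepend i ` B) = emeasure ?R B"
      using B assms by (simp add: emeasure_mu_prepend)
  qed
  finally show ?thesis
    by (simp only: measure_of_of_measure)
qed

lemma AE_Phi_eq:
  assumes "i < N" and \<psi>: "\<psi> \<in> sq_integrable (mu N A)"
  shows "AE x in mu N A. x \<in> Dset N A i \<longrightarrow> \<psi> x \<noteq> 0 \<longrightarrow> Phi N A i x = ratio"
proof -
  let ?M = "restrict_space (mu N A) (Dset N A i)"
  have D: "Dset N A i \<inter> space (mu N A) \<in> sets (mu N A)"
    using Dset_sets sets.top by (rule sets.Int)
  have "density ?M (RN_deriv ?M (mu_prepend N A i)) = density ?M (\<lambda>_. ennreal ratio)"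
    using RN_derivI[of "\<lambda>_. ennreal ratio" ?M "mu_prepend N A i"] mu_prepend_eq_density[OF assms(1)]
    by simp
  moreover have "\<psi> \<in> sq_integrable ?M"
    using \<psi> integrable_mult_indicator[OF Dset_sets sq_integrable_integrable[OF \<psi>], of i]
    by (simp add: sq_integrable_def integrable_restrict_space[OF D] measurable_restrict_space1)
  ultimately have "AE x in ?M. \<psi> x \<noteq> 0 \<longrightarrow> RN_deriv ?M (mu_prepend N A i) x = ennreal ratio"
    by (intro AE_density_const_unique) auto
  then have "AE x in mu N A. x \<in> Dset N A i \<longrightarrow> \<psi> x \<noteq> 0 \<longrightarrow>
      RN_deriv ?M (mu_prepend N A i) x = ennreal ratio"
    by (subst (asm) AE_restrict_space_iff[OF D])
  then show ?thesis
    by eventually_elim (use ratio_pos in \<open>auto simp: Phi_def\<close>)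
qed

text \<open>On \<open>R\<^sub>i\<close> the shift inverts \<open>\<sigma>\<^sub>i\<close>, hence transports the measure to \<open>ratio\<close> times the one on \<open>D\<^sub>i\<close>.\<close>

lemma distr_shift:
  assumes "i < N"
  shows "distr (density (mu N A) (\<lambda>x. ennreal (indicator (Rset N A i) x))) (mu N A) shift =
    density (mu N A) (\<lambda>x. ennreal (ratio * indicator (Dset N A i) x))"
proof (rule measure_eqI)
  fix E
  assume "E \<in> sets (distr (density (mu N A) (\<lambda>x. ennreal (indicator (Rset N A i) x))) (mu N A) shift)"
  then have E [measurable]: "E \<in> sets (mu N A)"
    by simp
  have pre [measurable]: "shift -` E \<inter> space (mu N A) \<in> sets (mu N A)"
    by measurable
  have "emeasure (distr (density (mu N A) (\<lambda>x. ennreal (indicator (Rset N A i) x))) (mu N A) shift) E =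
      (\<integral>\<^sup>+x. indicator (Rset N A i \<inter> (shift -` E \<inter> space (mu N A))) x \<partial>mu N A)"
    using pre by (auto simp: emeasure_distr emeasure_density ennreal_indicator indicator_inter_arith
        simp del: nn_integral_indicator)
  also have "\<dots> = emeasure (mu N A) (Rset N A i \<inter> (shift -` E \<inter> space (mu N A)))"
    using pre by simp
  also have "Rset N A i \<inter> (shift -` E \<inter> space (mu N A)) = prepend i ` (Dset N A i \<inter> E)"
    using assms Rset_subset shift_Rset by (subst prepend_image_eq) auto
  also have "emeasure (mu N A) \<dots> = ennreal ratio * emeasure (mu N A) (Dset N A i \<inter> E)"
    using assms by (intro emeasure_mu_prepend) auto
  also have "\<dots> = (\<integral>\<^sup>+x. ennreal ratio * indicator (Dset N A i \<inter> E) x \<partial>mu N A)"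
    by (simp add: nn_integral_cmult_indicator)
  also have "\<dots> = emeasure (density (mu N A) (\<lambda>x. ennreal (ratio * indicator (Dset N A i) x))) E"
    using ratio_pos by (auto simp: emeasure_density intro!: nn_integral_cong split: split_indicator)
  finally show "emeasure (distr (density (mu N A) (\<lambda>x. ennreal (indicator (Rset N A i) x))) (mu N A) shift) E =
      emeasure (density (mu N A) (\<lambda>x. ennreal (ratio * indicator (Dset N A i) x))) E" .
qed simp

lemma
  fixes f :: "(nat \<Rightarrow> nat) \<Rightarrow> 'b::{banach, second_countable_topology}"
  assumes "i < N" and [measurable]: "f \<in> borel_measurable (mu N A)"
  shows integral_Rset_shift:
      "(LINT x|mu N A. indicator (Rset N A i) x *\<^sub>R f (shift x)) =
       (LINT x|mu N A. (ratio * indicator (Dset N A i) x) *\<^sub>R f x)"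
    and integrable_Rset_shift_iff:
      "integrable (mu N A) (\<lambda>x. indicator (Rset N A i) x *\<^sub>R f (shift x)) \<longleftrightarrow>
       integrable (mu N A) (\<lambda>x. (ratio * indicator (Dset N A i) x) *\<^sub>R f x)"
proof -
  let ?R = "density (mu N A) (\<lambda>x. ennreal (indicator (Rset N A i) x))"
  have shift [measurable]: "shift \<in> measurable ?R (mu N A)"
    by simp
  have "(LINT x|mu N A. indicator (Rset N A i) x *\<^sub>R f (shift x)) = (LINT x|?R. f (shift x))"
    by (subst integral_density) auto
  also have "\<dots> = (LINT x|distr ?R (mu N A) shift. f x)"
    by (subst integral_distr) auto
  also have "\<dots> = (LINT x|mu N A. (ratio * indicator (Dset N A i) x) *\<^sub>R f x)"
    unfolding distr_shift[OF assms(1)] using ratio_pos by (subst integral_density) auto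
  finally show "(LINT x|mu N A. indicator (Rset N A i) x *\<^sub>R f (shift x)) =
       (LINT x|mu N A. (ratio * indicator (Dset N A i) x) *\<^sub>R f x)" .
  have "integrable (mu N A) (\<lambda>x. indicator (Rset N A i) x *\<^sub>R f (shift x)) \<longleftrightarrow>
      integrable ?R (\<lambda>x. f (shift x))"
    by (subst integrable_density) auto
  also have "\<dots> \<longleftrightarrow> integrable (distr ?R (mu N A) shift) f"
    by (subst integrable_distr_eq) auto
  also have "\<dots> \<longleftrightarrow> integrable (mu N A) (\<lambda>x. (ratio * indicator (Dset N A i) x) *\<^sub>R f x)"
    unfolding distr_shift[OF assms(1)] using ratio_pos by (subst integrable_density) auto
  finally show "integrable (mu N A) (\<lambda>x. indicator (Rset N A i) x *\<^sub>R f (shift x)) \<longleftrightarrow>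
       integrable (mu N A) (\<lambda>x. (ratio * indicator (Dset N A i) x) *\<^sub>R f x)" .
qed

lemma AE_Rset_shift:
  assumes "i < N" and "AE x in mu N A. x \<in> Dset N A i \<longrightarrow> P x"
  shows "AE x in mu N A. x \<in> Rset N A i \<longrightarrow> P (shift x)"
proof -
  let ?R = "density (mu N A) (\<lambda>x. ennreal (indicator (Rset N A i) x))"
  have "AE x in density (mu N A) (\<lambda>x. ennreal (ratio * indicator (Dset N A i) x)). P x"
    using assms(2) by (subst AE_density) (auto elim!: eventually_mono split: split_indicator_asm)
  then have "AE x in distr ?R (mu N A) shift. P x"
    by (simp only: distr_shift[OF assms(1)])
  then have "AE x in ?R. P (shift x)"
    by (rule AE_distrD[rotated]) simp
  then show ?thesis
    by (subst (asm) AE_density) (auto elim!: eventually_mono split: split_indicator_asm)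
qed

text \<open>
  The operator \<open>T\<^sub>i\<close> with the constant \<open>ratio\<close> in place of the Radon--Nikodym derivative, and its
  adjoint, both on representatives.
\<close>

definition shift_iso :: "nat \<Rightarrow> ((nat \<Rightarrow> nat) \<Rightarrow> complex) \<Rightarrow> (nat \<Rightarrow> nat) \<Rightarrow> complex" where
  "shift_iso i \<psi> x = indicator (Rset N A i) x * of_real (ratio powr (- 1 / 2)) * \<psi> (shift x)"

definition shift_iso_adj :: "nat \<Rightarrow> ((nat \<Rightarrow> nat) \<Rightarrow> complex) \<Rightarrow> (nat \<Rightarrow> nat) \<Rightarrow> complex" where
  "shift_iso_adj i \<phi> x = indicator (Dset N A i) x * of_real (ratio powr (1 / 2)) * \<phi> (prepend_total N A i x)"

lemma ratio_half: "(ratio powr (1 / 2))\<^sup>2 = ratio" "(ratio powr (- 1 / 2))\<^sup>2 = 1 / ratio"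
  "ratio powr (1 / 2) * ratio powr (- 1 / 2) = 1"
  "ratio * ratio powr (- 1 / 2) = ratio powr (1 / 2)"
  using ratio_pos powr_add[of ratio 1 "- 1 / 2"]
  by (simp_all add: power2_eq_square powr_minus_divide flip: powr_add)

lemma T_fun_AE_eq_shift_iso:
  assumes "i < N" "\<psi> \<in> sq_integrable (mu N A)"
  shows "AE x in mu N A. T_fun N A i \<psi> x = shift_iso i \<psi> x"
  using AE_Rset_shift[OF assms(1) AE_Phi_eq[OF assms]]
  by eventually_elim (auto simp: T_fun_def shift_iso_def split: split_indicator)

lemma shift_iso_measurable:
  assumes [measurable]: "\<psi> \<in> borel_measurable (mu N A)"
  shows "shift_iso i \<psi> \<in> borel_measurable (mu N A)"
  unfolding shift_iso_def by measurable

lemma shift_iso_adj_measurable: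
  assumes "i < N" and [measurable]: "\<psi> \<in> borel_measurable (mu N A)"
  shows "shift_iso_adj i \<psi> \<in> borel_measurable (mu N A)"
proof -
  note prepend_total_measurable[OF assms(1), measurable]
  show ?thesis
    unfolding shift_iso_adj_def by measurable
qed

lemma shift_iso_sq_integrable:
  assumes "i < N" and \<psi>: "\<psi> \<in> sq_integrable (mu N A)"
  shows "shift_iso i \<psi> \<in> sq_integrable (mu N A)"
    and "(LINT x|mu N A. (cmod (shift_iso i \<psi> x))\<^sup>2) \<le> (LINT x|mu N A. (cmod (\<psi> x))\<^sup>2)"
proof -
  note [measurable] = sq_integrable_measurable[OF \<psi>]
  \<comment> \<open>Chosen so that \<open>\<bar>shift_iso i \<psi>\<bar>\<^sup>2\<close> is \<open>f \<circ> shift\<close> on \<open>R\<^sub>i\<close>.\<close>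
  define f where "f x = (1 / ratio) *\<^sub>R (cmod (\<psi> x))\<^sup>2" for x
  have f_meas [measurable]: "f \<in> borel_measurable (mu N A)"
    unfolding f_def by measurable
  have sq: "(cmod (shift_iso i \<psi> x))\<^sup>2 = indicator (Rset N A i) x *\<^sub>R f (shift x)" for x
    using ratio_half by (simp add: shift_iso_def f_def norm_mult power_mult_distrib split: split_indicator)
  have f: "(ratio * indicator (Dset N A i) x) *\<^sub>R f x = indicator (Dset N A i) x *\<^sub>R (cmod (\<psi> x))\<^sup>2" for x
    using ratio_pos by (simp add: f_def)
  have int: "integrable (mu N A) (\<lambda>x. indicator (Dset N A i) x *\<^sub>R (cmod (\<psi> x))\<^sup>2)"
    by (rule integrable_mult_indicator[OF Dset_sets sq_integrable_integrable[OF \<psi>]])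
  show "shift_iso i \<psi> \<in> sq_integrable (mu N A)"
    using int shift_iso_measurable[of \<psi>] integrable_Rset_shift_iff[OF assms(1) f_meas]
    unfolding f by (simp add: sq_integrable_def sq)
  have "(LINT x|mu N A. (cmod (shift_iso i \<psi> x))\<^sup>2) =
      (LINT x|mu N A. indicator (Dset N A i) x *\<^sub>R (cmod (\<psi> x))\<^sup>2)"
    unfolding sq by (simp only: integral_Rset_shift[OF assms(1) f_meas] f)
  also have "\<dots> \<le> (LINT x|mu N A. (cmod (\<psi> x))\<^sup>2)"
    using int sq_integrable_integrable[OF \<psi>]
    by (intro integral_mono) (auto split: split_indicator)
  finally show "(LINT x|mu N A. (cmod (shift_iso i \<psi> x))\<^sup>2) \<le> (LINT x|mu N A. (cmod (\<psi> x))\<^sup>2)" .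
qed

lemma shift_iso_adj_sq_integrable:
  assumes "i < N" and \<phi>: "\<phi> \<in> sq_integrable (mu N A)"
  shows "shift_iso_adj i \<phi> \<in> sq_integrable (mu N A)"
proof -
  note [measurable] = sq_integrable_measurable[OF \<phi>] prepend_total_measurable[OF assms(1)]
  define f where "f x = (cmod (\<phi> (prepend_total N A i x)))\<^sup>2" for x
  have f_meas [measurable]: "f \<in> borel_measurable (mu N A)"
    unfolding f_def by measurable
  have sq: "(cmod (shift_iso_adj i \<phi> x))\<^sup>2 = (ratio * indicator (Dset N A i) x) *\<^sub>R f x" for x
    using ratio_half by (simp add: shift_iso_adj_def f_def norm_mult power_mult_distrib split: split_indicator)
  have f: "indicator (Rset N A i) x *\<^sub>R f (shift x) = indicator (Rset N A i) x *\<^sub>R (cmod (\<phi> x))\<^sup>2" for x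
    by (simp add: f_def prepend_total_shift split: split_indicator)
  have "integrable (mu N A) (\<lambda>x. indicator (Rset N A i) x *\<^sub>R (cmod (\<phi> x))\<^sup>2)"
    by (rule integrable_mult_indicator[OF Rset_sets sq_integrable_integrable[OF \<phi>]])
  then show ?thesis
    using shift_iso_adj_measurable[OF assms(1), of \<phi>] integrable_Rset_shift_iff[OF assms(1) f_meas]
    unfolding f by (simp add: sq_integrable_def sq)
qed

lemma shift_iso_adjoint:
  assumes "i < N" and \<psi>: "\<psi> \<in> sq_integrable (mu N A)" and \<phi>: "\<phi> \<in> sq_integrable (mu N A)"
  shows "(LINT x|mu N A. shift_iso i \<psi> x * cnj (\<phi> x)) = (LINT x|mu N A. \<psi> x * cnj (shift_iso_adj i \<phi> x))"
proof -
  note [measurable] = sq_integrable_measurable[OF \<psi>] sq_integrable_measurable[OF \<phi>]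
    prepend_total_measurable[OF assms(1)]
  define f where "f x = of_real (ratio powr (- 1 / 2)) * (\<psi> x * cnj (\<phi> (prepend_total N A i x)))" for x
  have [measurable]: "cnj \<in> borel_measurable borel"
    by (intro borel_measurable_continuous_onI continuous_intros)
  have f_meas [measurable]: "f \<in> borel_measurable (mu N A)"
    unfolding f_def by measurable
  have "shift_iso i \<psi> x * cnj (\<phi> x) = indicator (Rset N A i) x *\<^sub>R f (shift x)" for x
    by (simp add: shift_iso_def f_def prepend_total_shift split: split_indicator)
  moreover have "\<psi> x * cnj (shift_iso_adj i \<phi> x) = (ratio * indicator (Dset N A i) x) *\<^sub>R f x" for x
    using ratio_half(4) by (simp add: shift_iso_adj_def f_def scaleR_conv_of_real flip: of_real_mult split: split_indicator)
  ultimately show ?thesis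
    using integral_Rset_shift[OF assms(1), of f] by simp
qed

lemma T_fun_sq_integrable:
  assumes "i < N" and \<psi>: "\<psi> \<in> sq_integrable (mu N A)"
  shows "T_fun N A i \<psi> \<in> sq_integrable (mu N A)"
proof (rule sq_integrable_bound)
  note [measurable] = sq_integrable_measurable[OF \<psi>]
  let ?M = "restrict_space (mu N A) (Dset N A i)"
  \<comment> \<open>The derivative is measurable on \<open>D\<^sub>i\<close> only, hence it is extended by 0.\<close>
  define P where "P x = (if x \<in> Dset N A i then Phi N A i x else 0)" for x
  have "Phi N A i \<in> borel_measurable ?M"
    unfolding Phi_def by measurable
  moreover have "Dset N A i \<inter> space (mu N A) \<in> sets (mu N A)"
    using Dset_sets sets.top by (rule sets.Int)
  ultimately have [measurable]: "P \<in> borel_measurable (mu N A)"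
    unfolding P_def by (subst (asm) measurable_restrict_space_iff[where c = 0]) auto
  have "T_fun N A i \<psi> = (\<lambda>x. indicator (Rset N A i) x * of_real (P (shift x) powr (- 1 / 2)) * \<psi> (shift x))"
    by (rule ext) (auto simp: T_fun_def P_def shift_Rset split: split_indicator)
  then show "T_fun N A i \<psi> \<in> borel_measurable (mu N A)"
    by simp
  show "integrable (mu N A) (\<lambda>x. (cmod (shift_iso i \<psi> x))\<^sup>2)"
    by (rule sq_integrable_integrable[OF shift_iso_sq_integrable(1)[OF assms]])
  show "AE x in mu N A. (cmod (T_fun N A i \<psi> x))\<^sup>2 \<le> (cmod (shift_iso i \<psi> x))\<^sup>2"
    using T_fun_AE_eq_shift_iso[OF assms] by eventually_elim simp
qed

lemma T_op_class:
  assumes "i < N" and \<psi>: "\<psi> \<in> sq_integrable (mu N A)"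
  shows "T_op N A i (L2_class (mu N A) \<psi>) = L2_class (mu N A) (T_fun N A i \<psi>)"
  unfolding T_op_def
proof (rule L2_lift)
  fix \<phi>
  assume \<phi>: "\<phi> \<in> sq_integrable (mu N A)"
  show "T_fun N A i \<phi> \<in> sq_integrable (mu N A)"
    using assms(1) \<phi> by (rule T_fun_sq_integrable)
  assume "AE x in mu N A. \<psi> x = \<phi> x"
  then have "AE x in mu N A. x \<in> Rset N A i \<longrightarrow> \<psi> (shift x) = \<phi> (shift x)"
    by (intro AE_Rset_shift assms(1)) auto
  then show "AE x in mu N A. T_fun N A i \<psi> x = T_fun N A i \<phi> x"
    by eventually_elim (auto simp: T_fun_def split: split_indicator)
qed (rule \<psi>)

lemma T_op_class_shift_iso:
  assumes "i < N" and \<psi>: "\<psi> \<in> sq_integrable (mu N A)"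
  shows "T_op N A i (L2_class (mu N A) \<psi>) = L2_class (mu N A) (shift_iso i \<psi>)"
  using T_fun_AE_eq_shift_iso[OF assms] T_fun_sq_integrable[OF assms] shift_iso_sq_integrable(1)[OF assms]
  by (simp add: T_op_class[OF assms] L2_class_eq_iff)

lemma hadjoint_T_op:
  assumes "i < N" and \<phi>: "\<phi> \<in> sq_integrable (mu N A)"
  shows "hadjoint (L2_space (mu N A)) (T_op N A i) (L2_class (mu N A) \<phi>) = L2_class (mu N A) (shift_iso_adj i \<phi>)"
  using assms
  by (intro complex_hilbert_space.hadjoint_eqI[OF complex_hilbert_space_L2])
    (auto elim!: L2_carrierE simp: L2_class_closed shift_iso_adj_sq_integrable T_op_class_shift_iso L2_inner
      shift_iso_sq_integrable(1) shift_iso_adjoint)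

lemma shift_iso_adj_shift_iso: "shift_iso_adj i (shift_iso i \<psi>) x = indicator (Dset N A i) x * \<psi> x" if "i < N"
proof (cases "x \<in> Dset N A i")
  case True
  have "complex_of_real (ratio powr (1 / 2)) * of_real (ratio powr (- 1 / 2)) = 1"
    using ratio_half(3) by (simp only: of_real_mult[symmetric] of_real_1)
  then show ?thesis
    using True prepend_Dset[OF True that]
    by (simp add: shift_iso_adj_def shift_iso_def prepend_total_def mult.assoc[symmetric])
qed (simp add: shift_iso_adj_def)

lemma shift_iso_shift_iso_adj: "shift_iso i (shift_iso_adj i \<psi>) x = indicator (Rset N A i) x * \<psi> x"
proof (cases "x \<in> Rset N A i")
  case True
  have "complex_of_real (ratio powr (- 1 / 2)) * of_real (ratio powr (1 / 2)) = 1"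
    using ratio_half(3) by (simp only: of_real_mult[symmetric] of_real_1 mult.commute)
  then show ?thesis
    using True shift_Rset[OF True]
    by (simp add: shift_iso_adj_def shift_iso_def prepend_total_shift mult.assoc[symmetric])
qed (simp add: shift_iso_def)

lemma sum_indicator_Rset:
  assumes "x \<in> Lam N A"
  shows "(\<Sum>j<N. a j * (indicator (Rset N A j) x * z)) = a (x 0) * (z :: complex)"
proof -
  have "(\<Sum>j<N. a j * (indicator (Rset N A j) x * z)) = (\<Sum>j<N. if j = x 0 then a j * z else 0)"
    using assms by (intro sum.cong) (auto simp: Rset_def)
  then show ?thesis
    using assms by (simp add: Lam_def)
qed

lemma T_op_cuntz_krieger: "cuntz_krieger_rep N A (L2_space (mu N A)) (T_op N A)"
  unfolding cuntz_krieger_rep_def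
proof (intro conjI allI impI ballI)
  let ?H = "L2_space (mu N A)"
  show "complex_hilbert_space ?H"
    by (rule complex_hilbert_space_L2)
  note shift_iso_sq = shift_iso_sq_integrable(1) and adj_sq = shift_iso_adj_sq_integrable
  note ops = T_op_class_shift_iso hadjoint_T_op shift_iso_sq adj_sq
  {
    fix i
    assume i: "i < N"
    have shift_iso_add: "shift_iso i (\<lambda>x. f x + g x) = (\<lambda>x. shift_iso i f x + shift_iso i g x)" for f g
      by (rule ext) (simp add: shift_iso_def distrib_left)
    have shift_iso_scale: "shift_iso i (\<lambda>x. c * f x) = (\<lambda>x. c * shift_iso i f x)" for c f
      by (rule ext) (simp add: shift_iso_def)
    show "hbounded_op ?H (T_op N A i)"
      unfolding hbounded_op_def
    proof (intro conjI ballI allI exI)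
      fix F
      assume "F \<in> hcarrier ?H"
      then obtain f where f: "f \<in> sq_integrable (mu N A)" "F = L2_class (mu N A) f"
        by (rule L2_carrierE)
      show "T_op N A i F \<in> hcarrier ?H"
        using f i by (simp add: ops L2_class_closed)
      show "T_op N A i (hscale ?H c F) = hscale ?H c (T_op N A i F)" for c
        using f i by (simp add: ops L2_scale sq_integrable_scale shift_iso_scale)
      show "hnorm ?H (T_op N A i F) \<le> 1 * hnorm ?H F"
        using f i by (simp add: ops L2_norm shift_iso_sq_integrable(2))
      fix G
      assume "G \<in> hcarrier ?H"
      then obtain g where "g \<in> sq_integrable (mu N A)" "G = L2_class (mu N A) g"
        by (rule L2_carrierE)
      then show "T_op N A i (hadd ?H F G) = hadd ?H (T_op N A i F) (T_op N A i G)"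
        using f i by (simp add: ops L2_add sq_integrable_add shift_iso_add)
    qed
    show "hpartial_isometry ?H (T_op N A i)"
      unfolding hpartial_isometry_def
    proof
      fix F
      assume "F \<in> hcarrier ?H"
      then obtain f where f: "f \<in> sq_integrable (mu N A)" "F = L2_class (mu N A) f"
        by (rule L2_carrierE)
      have "shift_iso i (shift_iso_adj i (shift_iso i f)) = shift_iso i f"
        unfolding shift_iso_shift_iso_adj[abs_def] by (rule ext) (simp add: shift_iso_def split: split_indicator)
      then show "T_op N A i (hadjoint ?H (T_op N A i) (T_op N A i F)) = T_op N A i F"
        using f i by (simp add: ops)
    qed
  }
  fix F
  assume "F \<in> hcarrier ?H"
  then obtain f where f: "f \<in> sq_integrable (mu N A)" "F = L2_class (mu N A) f"
    by (rule L2_carrierE)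
  have range: "hsum ?H (\<lambda>j. hscale ?H (a j) (T_op N A j (hadjoint ?H (T_op N A j) F))) N =
      L2_class (mu N A) (\<lambda>x. \<Sum>j<N. a j * (indicator (Rset N A j) x * f x))"
    and range_sq: "(\<lambda>x. \<Sum>j<N. a j * (indicator (Rset N A j) x * f x)) \<in> sq_integrable (mu N A)" for a
  proof -
    have "hsum ?H (\<lambda>j. hscale ?H (a j) (T_op N A j (hadjoint ?H (T_op N A j) F))) N =
        L2_class (mu N A) (\<lambda>x. \<Sum>j<N. a j * shift_iso j (shift_iso_adj j f) x)"
      using f by (intro L2_sum) (simp_all add: ops L2_scale sq_integrable_scale)
    then show "hsum ?H (\<lambda>j. hscale ?H (a j) (T_op N A j (hadjoint ?H (T_op N A j) F))) N =
        L2_class (mu N A) (\<lambda>x. \<Sum>j<N. a j * (indicator (Rset N A j) x * f x))"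
      by (simp add: shift_iso_shift_iso_adj)
    have "(\<lambda>x. \<Sum>j<N. a j * shift_iso j (shift_iso_adj j f) x) \<in> sq_integrable (mu N A)"
      using f by (intro sq_integrable_sum sq_integrable_scale ops) auto
    then show "(\<lambda>x. \<Sum>j<N. a j * (indicator (Rset N A j) x * f x)) \<in> sq_integrable (mu N A)"
      by (simp add: shift_iso_shift_iso_adj)
  qed
  show "hadjoint ?H (T_op N A i) (T_op N A i F) =
      hsum ?H (\<lambda>j. hscale ?H (of_nat (A i j)) (T_op N A j (hadjoint ?H (T_op N A j) F))) N"
    if i: "i < N" for i
  proof -
    have "shift_iso_adj i (shift_iso i f) x = (\<Sum>j<N. of_nat (A i j) * (indicator (Rset N A j) x * f x))"
      if x: "x \<in> Lam N A" for x
    proof -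
      have "A i (x 0) \<in> {0, 1}"
        using x zero_one[OF i, of "x 0"] by (auto simp: Lam_def)
      then show ?thesis
        using x i by (auto simp: shift_iso_adj_shift_iso sum_indicator_Rset Dset_def split: split_indicator)
    qed
    then have "AE x in mu N A. shift_iso_adj i (shift_iso i f) x =
        (\<Sum>j<N. of_nat (A i j) * (indicator (Rset N A j) x * f x))"
      by (intro AE_I2) simp
    then show ?thesis
      unfolding range
      using f i range_sq[of "\<lambda>j. of_nat (A i j)"] by (simp add: ops L2_class_eq_iff)
  qed
  show "hsum ?H (\<lambda>j. T_op N A j (hadjoint ?H (T_op N A j) F)) N = F"
  proof -
    have "(\<Sum>j<N. 1 * (indicator (Rset N A j) x * f x)) = f x" if "x \<in> Lam N A" for x
      using sum_indicator_Rset[OF that, of "\<lambda>_. 1"] by simp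
    then have "AE x in mu N A. (\<Sum>j<N. 1 * (indicator (Rset N A j) x * f x)) = f x"
      by (intro AE_I2) simp
    then have total: "L2_class (mu N A) (\<lambda>x. \<Sum>j<N. 1 * (indicator (Rset N A j) x * f x)) = F"
      using L2_class_eq_iff[OF range_sq[of "\<lambda>_. 1"] f(1)] by (simp only: f(2))
    have "hscale ?H 1 (T_op N A j (hadjoint ?H (T_op N A j) F)) =
        T_op N A j (hadjoint ?H (T_op N A j) F)" if "j < N" for j
      using f that by (simp add: ops L2_scale)
    then have "hsum ?H (\<lambda>j. T_op N A j (hadjoint ?H (T_op N A j) F)) N =
        hsum ?H (\<lambda>j. hscale ?H 1 (T_op N A j (hadjoint ?H (T_op N A j) F))) N"
      by (intro hsum_cong) simp
    also have "\<dots> = L2_class (mu N A) (\<lambda>x. \<Sum>j<N. 1 * (indicator (Rset N A j) x * f x))"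
      by (rule range)
    also have "\<dots> = F"
      by (rule total)
    finally show ?thesis .
  qed
qed

end

theorem proposition2p7:
  fixes N :: nat and A :: "nat \<Rightarrow> nat \<Rightarrow> nat"
  assumes "N \<ge> 2"
    and "\<And>i j. i < N \<Longrightarrow> j < N \<Longrightarrow> A i j \<in> {0, 1}"
    and "\<And>i. i < N \<Longrightarrow> A i i = 1"
  shows "(\<forall>i<N. \<forall>\<psi>\<in>sq_integrable (mu N A).
            T_fun N A i \<psi> \<in> sq_integrable (mu N A) \<and>
            T_op N A i (L2_class (mu N A) \<psi>) = L2_class (mu N A) (T_fun N A i \<psi>)) \<and>
         cuntz_krieger_rep N A (L2_space (mu N A)) (T_op N A)"
proof -
  interpret transition_matrix N A
    using assms(1,2) by unfold_locales auto
  show ?thesis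
    by (simp add: T_fun_sq_integrable T_op_class T_op_cuntz_krieger)
qed

end
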